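(* Let $r\ge 1$ and let $F(x,y) = \sum_{j=0}^{r} f_{j}(x) y^{j} \in \mathbb Z[x,y]$ with $f_{r}(x) \ne 0$. Suppose $F(x,y)$ is irreducible in $\mathbb Z[x,y]$ and at least one $f_{j}(x)$ is non-constant. Let $\mathcal P$ be the set of odd primes $p$ satisfying \[ p \le \max\{ \deg f_{0}, \dots, \deg f_{r}, H(f_{0}), \dots, H(f_{r}) \}. \] Then for a positive integer $n$, $F(x,y^{n})$ is reducible in $\mathbb Z[x,y]$ if and only if either $p\mid n$ and $F(x,y^{p})$ is reducible for some $p \in \mathcal P$, or $2\mid n$ and $F(x,y^{2})$ is reducible, or $4\mid n$ and $F(x,y^{4})$ is reducible. In particular, if $F(x,y^{p})$ is irreducible for every $p \in \mathcal P$ and $F(x,y^{4})$ is irreducible, then $F(x,y^{n})$ is irreducible in $\mathbb Z[x,y]$ for every positive integer $n$. Furthermore, if $p \in \mathcal P \cup \{ 2 \}$ and $F(x,y^{p})$ is reducible, then there exist polynomials $g_0(x),\dots,g_r(x)\in\mathbb Z[x]$ such that \[ F(x,y) \equiv \sum_{j=0}^{r} g_{j}(x)^{p} y^{j} \pmod{p}. \]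
   Context: For $f(x)\in\mathbb Z[x]$, the height $H(f)$ is the maximum of the absolute values of the coefficients of $f(x)$. A congruence of polynomials modulo $p$ means the difference has all coefficients divisible by $p$. *)

theory Defs
  imports "HOL-Computational_Algebra.Polynomial_Factorial"
begin

text \<open>
  The ring of integer polynomials in \<open>x\<close> and \<open>y\<close> is the type \<open>int poly poly\<close>: the outer variable
  is \<open>y\<close> and the coefficients, of type \<open>int poly\<close>, are polynomials in \<open>x\<close>.
\<close>

definition reducible :: "'a::algebraic_semidom \<Rightarrow> bool" where
  "reducible a \<longleftrightarrow> a \<noteq> 0 \<and> \<not> is_unit a \<and> \<not> irreducible a"

definition height :: "int poly \<Rightarrow> int" where
  "height f = Max ((\<lambda>i. \<bar>coeff f i\<bar>) ` {..degree f})"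

text \<open>\<open>F(x, y\<^sup>n)\<close>\<close>

definition subst_y_power :: "int poly poly \<Rightarrow> nat \<Rightarrow> int poly poly" where
  "subst_y_power F n = F \<circ>\<^sub>p monom 1 n"

definition bipoly_cong :: "int poly poly \<Rightarrow> int poly poly \<Rightarrow> nat \<Rightarrow> bool" where
  "bipoly_cong F G p \<longleftrightarrow> (\<forall>j i. int p dvd coeff (coeff (F - G) j) i)"

text \<open>
  The convention \<open>degree 0 = 0\<close> is harmless here: all heights are nonnegative, so zero
  coefficients do not affect the maximum.
\<close>

definition exceptional_primes :: "nat \<Rightarrow> (nat \<Rightarrow> int poly) \<Rightarrow> nat set" where
  "exceptional_primes r f =
    {p. prime p \<and> odd p \<and>
        int p \<le> Max ((\<lambda>j. int (degree (f j))) ` {0..r} \<union> (\<lambda>j. height (f j)) ` {0..r})}"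

end

theory Submission
  imports Defs "Jordan_Normal_Form.Determinant"
begin

text \<open>
  Over the field \<open>K = \<rat>(x)\<close> the argument is a version of Capelli's theorem. If \<open>A \<in> K[t]\<close> is
  irreducible with root \<open>\<alpha> \<noteq> 0\<close> and \<open>q\<close> is prime, then \<open>A(y\<^sup>q)\<close> is reducible if and only if \<open>\<alpha>\<close> is
  a \<open>q\<close>-th power in \<open>K(\<alpha>)\<close>, i.e. \<open>A\<close> divides \<open>Q\<^sup>q - t\<close> for some \<open>Q\<close>. Taking norms from \<open>K[y]\<close> to
  \<open>K[y\<^sup>n]\<close> turns a relation of this kind for \<open>A(y\<^sup>n)\<close> into one for \<open>A\<close>, with \<open>t\<close> replaced by \<open>-t\<close> when
  \<open>n\<close> is even. Hence irreducibility of \<open>F(x, y\<^sup>n)\<close> only has to be tested at the prime divisors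
  of \<open>n\<close> and at \<open>4\<close>.

  For the congruence, let \<open>F(x, y\<^sup>p) = G H\<close> be a proper factorization. The norm \<open>N(G)\<close> divides \<open>F\<^sup>p\<close>,
  so \<open>N(G) = u F\<^sup>s\<close> with a unit \<open>u\<close> and \<open>0 < s < p\<close>. If \<open>G = \<Sum> g\<^sub>j y\<^sup>j\<close> and
  \<open>G' = \<Sum> g\<^sub>j\<^sup>p t\<^sup>j\<close>, then \<open>N(G)\<^sup>p = N(G\<^sup>p) \<equiv> N(G'(y\<^sup>p)) = G'\<^sup>p\<close> modulo \<open>p\<close>, so
  \<open>u F\<^sup>s \<equiv> G'\<close>. The \<open>x\<close>-derivative of \<open>G'\<close> vanishes modulo \<open>p\<close>, hence so does that of \<open>F\<close>. Thus
  every \<open>f\<^sub>j\<close> is modulo \<open>p\<close> a polynomial in \<open>x\<^sup>p\<close>, that is, a \<open>p\<close>-th power; and all \<open>f\<^sub>j\<close> are constant if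
  \<open>p\<close> exceeds their degrees and heights.
\<close>

hide_const (open) module.smult

section \<open>Norms modulo a monic polynomial\<close>

text \<open>Matrix of multiplication by \<open>f\<close> on \<open>R[y]/(P)\<close> in the basis
  \<open>1, y, ..., y^(d-1)\<close> with \<open>d = degree P\<close>. Pseudo-division makes sense
  over any domain, and for monic \<open>P\<close> it gives the true remainder.\<close>

definition mult_matrix :: "'a::idom poly \<Rightarrow> 'a poly \<Rightarrow> 'a mat" where
  "mult_matrix P f =
     mat (degree P) (degree P) (\<lambda>(i, j). coeff (pseudo_mod (f * monom 1 j) P) i)"

definition quot_norm :: "'a::idom poly \<Rightarrow> 'a poly \<Rightarrow> 'a" where
  "quot_norm P f = det (mult_matrix P f)"

locale monic_modulus =
  fixes P :: "'a::idom poly"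
  assumes monic: "lead_coeff P = 1"
begin

lemma P_nonzero: "P \<noteq> 0"
  using monic by auto

lemma dvd_pseudo_mod_diff: "P dvd f - pseudo_mod f P"
proof -
  obtain q r where qr: "pseudo_divmod f P = (q, r)" by (cases "pseudo_divmod f P")
  from pseudo_divmod(1)[OF P_nonzero qr] have "f = P * q + r"
    using monic by simp
  then show ?thesis using qr by (simp add: pseudo_mod_def)
qed

lemma coeff_pseudo_mod_eq_0: "degree P \<le> i \<Longrightarrow> coeff (pseudo_mod f P) i = 0"
  using pseudo_mod(2)[OF P_nonzero, of f] by (auto simp: coeff_eq_0)

lemma eq_0_if_dvd:
  assumes "P dvd h" "\<And>i. degree P \<le> i \<Longrightarrow> coeff h i = 0"
  shows "h = 0"
proof (rule ccontr)
  assume "h \<noteq> 0"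
  then have "degree P \<le> degree h" using assms(1) by (rule dvd_imp_degree_le[rotated])
  then show False using assms(2) \<open>h \<noteq> 0\<close> by fastforce
qed

text \<open>A multiple of the monic \<open>P\<close> with no terms from \<open>degree P\<close>
  upwards is zero, so remainders are unique.\<close>

lemma pseudo_mod_eqI:
  assumes "P dvd f - r" "\<And>i. degree P \<le> i \<Longrightarrow> coeff r i = 0"
  shows "pseudo_mod f P = r"
proof -
  have "P dvd pseudo_mod f P - r"
    using dvd_diff[OF assms(1) dvd_pseudo_mod_diff[of f]] by simp
  then have "pseudo_mod f P - r = 0"
    by (rule eq_0_if_dvd) (simp add: assms(2) coeff_pseudo_mod_eq_0)
  then show ?thesis by simp
qed

lemma pseudo_mod_cong: "P dvd f - g \<Longrightarrow> pseudo_mod f P = pseudo_mod g P"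
  using dvd_add[of P "f - g" "g - pseudo_mod g P"]
  by (intro pseudo_mod_eqI) (auto simp: dvd_pseudo_mod_diff coeff_pseudo_mod_eq_0)

lemma pseudo_mod_add: "pseudo_mod (f + g) P = pseudo_mod f P + pseudo_mod g P"
proof (rule pseudo_mod_eqI)
  show "P dvd f + g - (pseudo_mod f P + pseudo_mod g P)"
    using dvd_add[OF dvd_pseudo_mod_diff[of f] dvd_pseudo_mod_diff[of g]]
    by (simp add: algebra_simps)
qed (simp add: coeff_pseudo_mod_eq_0)

lemma pseudo_mod_smult: "pseudo_mod (smult c f) P = smult c (pseudo_mod f P)"
proof (rule pseudo_mod_eqI)
  show "P dvd smult c f - smult c (pseudo_mod f P)"
    using dvd_smult[OF dvd_pseudo_mod_diff[of f], of c]
    by (simp add: smult_diff_right)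
qed (simp add: coeff_pseudo_mod_eq_0)

lemma pseudo_mod_0: "pseudo_mod 0 P = 0"
  by (rule pseudo_mod_eqI) auto

lemma pseudo_mod_sum: "pseudo_mod (sum f I) P = (\<Sum>i\<in>I. pseudo_mod (f i) P)"
  by (induction I rule: infinite_finite_induct) (auto simp: pseudo_mod_0 pseudo_mod_add)

lemma pseudo_mod_as_sum:
  "pseudo_mod f P = (\<Sum>k<degree P. smult (coeff (pseudo_mod f P) k) (monom 1 k))"
  by (rule poly_eqI) (auto simp: coeff_sum coeff_pseudo_mod_eq_0 not_less if_distrib cong: if_cong)

lemma mult_matrix_carrier [simp]: "mult_matrix P f \<in> carrier_mat (degree P) (degree P)"
  by (simp add: mult_matrix_def)

text \<open>Replacing \<open>g y^j\<close> by its remainder before multiplying by \<open>f\<close>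
  changes nothing modulo \<open>P\<close>; expanding that remainder in the basis gives the matrix
  product.\<close>

lemma mult_matrix_mult: "mult_matrix P (f * g) = mult_matrix P f * mult_matrix P g"
proof (rule eq_matI, goal_cases)
  case (1 i j)
  then have ij: "i < degree P" "j < degree P" by (simp_all add: mult_matrix_def)
  define c where "c k = coeff (pseudo_mod (g * monom 1 j) P) k" for k
  have "P dvd f * (g * monom 1 j - pseudo_mod (g * monom 1 j) P)"
    by (rule dvd_mult) (rule dvd_pseudo_mod_diff)
  then have "pseudo_mod (f * g * monom 1 j) P = pseudo_mod (f * pseudo_mod (g * monom 1 j) P) P"
    by (intro pseudo_mod_cong) (simp add: algebra_simps)
  also have "f * pseudo_mod (g * monom 1 j) P = (\<Sum>k<degree P. smult (c k) (f * monom 1 k))"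
    by (subst pseudo_mod_as_sum) (simp add: c_def sum_distrib_left)
  finally have "coeff (pseudo_mod (f * g * monom 1 j) P) i =
      (\<Sum>k<degree P. c k * coeff (pseudo_mod (f * monom 1 k) P) i)"
    by (simp add: pseudo_mod_sum pseudo_mod_smult coeff_sum)
  then show ?case using ij
    by (simp add: mult_matrix_def scalar_prod_def c_def mult.commute atLeast0LessThan)
qed (simp_all add: mult_matrix_def)

lemma quot_norm_mult: "quot_norm P (f * g) = quot_norm P f * quot_norm P g"
  unfolding quot_norm_def mult_matrix_mult
  by (rule det_mult[OF mult_matrix_carrier mult_matrix_carrier])

lemma quot_norm_const: "quot_norm P [:c:] = c ^ degree P"
proof -
  have "mult_matrix P [:c:] = c \<cdot>\<^sub>m 1\<^sub>m (degree P)"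
  proof (rule eq_matI, goal_cases)
    case (1 i j)
    then have "pseudo_mod ([:c:] * monom 1 j) P = monom c j"
      by (intro pseudo_mod_eqI) (auto simp: smult_monom)
    then show ?case using 1 by (simp add: mult_matrix_def)
  qed (simp_all add: mult_matrix_def)
  then show ?thesis by (simp add: quot_norm_def)
qed

lemma quot_norm_power: "quot_norm P (f ^ n) = quot_norm P f ^ n"
  using quot_norm_const[of 1] by (induction n) (simp_all add: quot_norm_mult one_pCons)

text \<open>Modulo \<open>a\<close>, both polynomials act alike on the quotient by \<open>P\<close>,
  so their matrices agree entrywise modulo \<open>a\<close>; the determinant is an integer
  polynomial in the entries.\<close>

lemma quot_norm_cong:
  assumes "f - g = P * s + smult a u"
  shows "a dvd quot_norm P f - quot_norm P g"
proof -
  let ?d = "degree P"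
  have entry: "a dvd mult_matrix P f $$ (i, j) - mult_matrix P g $$ (i, j)"
    if "i < ?d" "j < ?d" for i j
  proof -
    have "f * monom 1 j - (g * monom 1 j + smult a (u * monom 1 j)) = (f - g - smult a u) * monom 1 j"
      by (simp add: algebra_simps)
    also have "\<dots> = P * (s * monom 1 j)" using assms by simp
    finally have "pseudo_mod (f * monom 1 j) P =
        pseudo_mod (g * monom 1 j) P + smult a (pseudo_mod (u * monom 1 j) P)"
      by (subst pseudo_mod_smult[symmetric], subst pseudo_mod_add[symmetric],
          intro pseudo_mod_cong) auto
    then show ?thesis using that by (simp add: mult_matrix_def)
  qed
  have prod: "a dvd (\<Prod>i\<in>I. x i) - (\<Prod>i\<in>I. y i)"
    if "finite I" "\<And>i. i \<in> I \<Longrightarrow> a dvd x i - y i" for I :: "nat set" and x y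
    using that
  proof (induction I rule: finite_induct)
    case (insert i I)
    have "x i * prod x I - y i * prod y I =
        (x i - y i) * prod x I + y i * (prod x I - prod y I)" by (simp add: algebra_simps)
    then show ?case using insert by (metis dvd_add dvd_mult dvd_mult2 insert_iff prod.insert)
  qed simp
  show ?thesis
    unfolding quot_norm_def det_def'[OF mult_matrix_carrier] sum_subtractf[symmetric]
      right_diff_distrib[symmetric]
    by (intro dvd_sum dvd_mult prod) (auto intro!: entry simp: permutes_def dest: permutes_in_image[THEN iffD2] permutes_in_image)
qed

text \<open>The adjugate inverts the matrix up to its determinant, so the norm is a multiple of
  \<open>f\<close> modulo \<open>P\<close>.\<close>

lemma dvd_mult_diff_quot_norm:
  assumes "degree P > 0"
  shows "\<exists>v. P dvd f * v - [:quot_norm P f:]"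
proof -
  let ?d = "degree P" and ?M = "mult_matrix P f"
  define B where "B = adj_mat ?M"
  have B: "B \<in> carrier_mat ?d ?d" and MB: "?M * B = det ?M \<cdot>\<^sub>m 1\<^sub>m ?d"
    using adj_mat[OF mult_matrix_carrier] by (auto simp: B_def)
  \<comment> \<open>The first column of the adjugate is the vector that multiplication by
    \<open>f\<close> sends to the norm times the basis element 1.\<close>
  define v where "v = (\<Sum>k<?d. smult (B $$ (k, 0)) (monom 1 k))"
  have "pseudo_mod (f * v) P = [:quot_norm P f:]"
  proof (rule poly_eqI)
    fix i
    have "pseudo_mod (f * v) P = (\<Sum>k<?d. smult (B $$ (k, 0)) (pseudo_mod (f * monom 1 k) P))"
      by (simp add: v_def sum_distrib_left pseudo_mod_sum pseudo_mod_smult)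
    then have "coeff (pseudo_mod (f * v) P) i = (?M * B) $$ (i, 0)" if "i < ?d"
      using that assms B
      by (simp add: mult_matrix_def scalar_prod_def coeff_sum mult.commute atLeast0LessThan)
    then show "coeff (pseudo_mod (f * v) P) i = coeff [:quot_norm P f:] i"
      using assms coeff_pseudo_mod_eq_0[of i]
      by (cases "i < ?d") (auto simp: MB quot_norm_def coeff_pCons split: nat.splits)
  qed
  then show ?thesis using dvd_pseudo_mod_diff[of "f * v"] by metis
qed

end

text \<open>The matrix is the companion matrix: \<open>y\<close> shifts the basis and sends
  \<open>y^(n-1)\<close> to \<open>c\<close>. The sign is what separates odd from even exponents
  later.\<close>

lemma quot_norm_X_binomial:
  fixes c :: "'a::idom"
  assumes "n > 0"
  shows "quot_norm (monom 1 n - [:c:]) (monom 1 1) = (-1) ^ Suc n * c"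
proof -
  define P where "P = monom 1 n - [:c:]"
  have deg: "degree P = n" and "lead_coeff P = 1"
  proof -
    have "degree [:-c:] < degree (monom (1::'a) n)" using assms by (simp add: degree_monom_eq)
    moreover have "P = monom 1 n + [:-c:]" by (simp add: P_def)
    ultimately show "degree P = n" by (simp add: degree_add_eq_left degree_monom_eq)
    then show "lead_coeff P = 1" using assms by (simp add: P_def coeff_pCons split: nat.splits)
  qed
  then interpret monic_modulus P by unfold_locales
  define M where "M = mult_matrix P (monom 1 1)"
  have low: "pseudo_mod (monom 1 1 * monom 1 j) P = monom 1 (Suc j)" if "Suc j < n" for j
    using that by (intro pseudo_mod_eqI) (auto simp: deg mult_monom)
  have top: "pseudo_mod (monom 1 1 * monom 1 (n - 1)) P = [:c:]"
    using assms
    by (intro pseudo_mod_eqI) (auto simp: P_def[symmetric] mult_monom deg coeff_pCons split: nat.splits)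
  have entry: "M $$ (i, j) = (if Suc j = n then if i = 0 then c else 0 else if i = Suc j then 1 else 0)"
    if "i < n" "j < n" for i j
  proof (cases "Suc j = n")
    case True
    then have "j = n - 1" by simp
    then show ?thesis using that top True
      by (simp add: M_def mult_matrix_def deg coeff_pCons split: nat.splits)
  next
    case False
    then show ?thesis using that low[of j] by (simp add: M_def mult_matrix_def deg)
  qed
  have M: "M \<in> carrier_mat n n" using mult_matrix_carrier deg unfolding M_def by metis
  have minor: "mat_delete M 0 (n - 1) = 1\<^sub>m (n - 1)"
    using M by (intro eq_matI) (auto simp: mat_delete_def entry)
  have "det M = (\<Sum>j<n. M $$ (0, j) * cofactor M 0 j)"
    using laplace_expansion_row[OF M assms] .
  also have "\<dots> = (\<Sum>j<n. if j = n - 1 then c * cofactor M 0 j else 0)"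
    using assms by (intro sum.cong) (auto simp: entry)
  also have "\<dots> = c * cofactor M 0 (n - 1)" using assms by simp
  also have "\<dots> = (-1) ^ Suc n * c"
    using assms minor by (cases n) (simp_all add: cofactor_def)
  finally show ?thesis by (simp add: quot_norm_def P_def M_def)
qed

section \<open>Substituting a power of the variable\<close>

lemma pcompose_monom_monom:
  "monom (1::'a::comm_ring_1) m \<circ>\<^sub>p monom 1 n = monom 1 (m * n)"
  by (induction m) (simp_all add: monom_Suc pcompose_pCons mult_monom pcompose_1 flip: one_pCons)

lemma pcompose_power: "p ^ k \<circ>\<^sub>p (q :: 'a::comm_ring_1 poly) = (p \<circ>\<^sub>p q) ^ k"
  by (induction k) (simp_all add: pcompose_1 pcompose_mult)

lemma pcompose_monom_pcompose_monom:
  "(A \<circ>\<^sub>p monom (1::'a::comm_ring_1) m) \<circ>\<^sub>p monom 1 n = A \<circ>\<^sub>p monom 1 (m * n)"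
  by (simp add: pcompose_assoc[symmetric] pcompose_monom_monom)

lemma monom_1_Suc_0: "monom (1::'a::comm_semiring_1) (Suc 0) = [:0, 1:]"
  by (simp add: monom_Suc)

lemma pcompose_dvd: "p dvd q \<Longrightarrow> p \<circ>\<^sub>p r dvd q \<circ>\<^sub>p (r :: 'a::comm_ring_1 poly)"
  by (auto simp: dvd_def pcompose_mult)

section \<open>Coordinates of \<open>R[y]\<close> over \<open>R[y^n]\<close>\<close>

definition poly_section :: "nat \<Rightarrow> nat \<Rightarrow> 'a::comm_ring_1 poly \<Rightarrow> 'a poly" where
  "poly_section n i W = (\<Sum>k\<le>degree W. monom (coeff W (n * k + i)) k)"

lemma coeff_sect: "n > 0 \<Longrightarrow> coeff (poly_section n i W) k = coeff W (n * k + i)"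
proof (cases "k \<le> degree W")
  case False
  assume "n > 0"
  then have "k \<le> n * k + i" by (simp add: trans_le_add1)
  then have "coeff W (n * k + i) = 0" using False by (intro coeff_eq_0) simp
  then show ?thesis using False by (simp add: poly_section_def coeff_sum)
qed (simp add: poly_section_def coeff_sum)

lemma poly_section_add: "n > 0 \<Longrightarrow> poly_section n i (V + W) = poly_section n i V + poly_section n i W"
  by (rule poly_eqI) (simp add: coeff_sect)

lemma poly_section_diff: "n > 0 \<Longrightarrow> poly_section n i (V - W) = poly_section n i V - poly_section n i W"
  by (rule poly_eqI) (simp add: coeff_sect)

lemma poly_section_sum: "n > 0 \<Longrightarrow> poly_section n i (sum f I) = (\<Sum>x\<in>I. poly_section n i (f x))"
  by (rule poly_eqI) (simp add: coeff_sect coeff_sum)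

lemma poly_section_monom:
  assumes "i < n" "m < n"
  shows "poly_section n i (monom (1::'a::comm_ring_1) m) = (if m = i then 1 else 0)"
proof (rule poly_eqI)
  fix k
  show "coeff (poly_section n i (monom (1::'a) m)) k = coeff (if m = i then 1 else 0) k"
    using assms by (cases k) (auto simp: coeff_sect)
qed

text \<open>Sections are the coordinates with respect to \<open>1, y, ..., y^(n-1)\<close> and so
  are linear over \<open>R[y^n]\<close>: multiplying by \<open>y^n\<close> raises the degree of each
  term of a section by one.\<close>

lemma poly_section_mult:
  assumes "i < n"
  shows "poly_section n i ((A \<circ>\<^sub>p monom 1 n) * W) = A * poly_section n i W"
proof (induction A)
  case (pCons a A)
  have "poly_section n i (smult a W + monom 1 n * ((A \<circ>\<^sub>p monom 1 n) * W)) =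
      smult a (poly_section n i W) + pCons 0 (poly_section n i ((A \<circ>\<^sub>p monom 1 n) * W))"
  proof (rule poly_eqI)
    fix k
    show "coeff (poly_section n i (smult a W + monom 1 n * ((A \<circ>\<^sub>p monom 1 n) * W))) k =
      coeff (smult a (poly_section n i W) + pCons 0 (poly_section n i ((A \<circ>\<^sub>p monom 1 n) * W))) k"
      using assms by (cases k) (simp_all add: coeff_sect coeff_monom_mult)
  qed
  then show ?case using pCons by (simp add: pcompose_pCons algebra_simps)
next
  case 0
  then show ?case by (simp add: poly_section_def)
qed

lemma poly_section_pcompose:
  assumes "i < n"
  shows "poly_section n i (A \<circ>\<^sub>p monom 1 n) = (if i = 0 then A else 0)"
proof -
  have "poly_section n i (1 :: 'a poly) = (if i = 0 then 1 else 0)"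
    using poly_section_monom[OF assms, of 0, where ?'a = 'a] assms
    by (auto simp: monom_0 simp flip: one_pCons)
  then show ?thesis using poly_section_mult[OF assms, of A 1] by simp
qed

lemma dvd_poly_section:
  assumes "i < n" "A \<circ>\<^sub>p monom 1 n dvd W"
  shows "A dvd poly_section n i W"
  using assms by (auto simp: poly_section_mult elim!: dvdE)

lemma coeff_pcompose_monom:
  assumes "n > 0"
  shows "coeff (A \<circ>\<^sub>p monom 1 n) k = (if n dvd k then coeff A (k div n) else (0::'a::comm_ring_1))"
proof -
  have "coeff (A \<circ>\<^sub>p monom 1 n) k = coeff (poly_section n (k mod n) (A \<circ>\<^sub>p monom 1 n)) (k div n)"
    using assms by (simp add: coeff_sect)
  also have "\<dots> = (if n dvd k then coeff A (k div n) else 0)"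
    using assms by (subst poly_section_pcompose) (auto simp: dvd_eq_mod_eq_0)
  finally show ?thesis .
qed

lemma poly_section_decomposition:
  assumes "n > 0"
  shows "W = (\<Sum>i<n. (poly_section n i W \<circ>\<^sub>p monom 1 n) * monom 1 i)"
proof (rule poly_eqI)
  fix k
  have eq: "coeff ((poly_section n i W \<circ>\<^sub>p monom 1 n) * monom 1 i) k = (if i = k mod n then coeff W k else 0)"
    if "i < n" for i
  proof -
    have "coeff ((poly_section n i W \<circ>\<^sub>p monom 1 n) * monom 1 i) k =
        (if i \<le> k \<and> n dvd k - i then coeff W (n * ((k - i) div n) + i) else 0)"
      using assms
      by (simp add: mult.commute[of _ "monom _ _"] coeff_monom_mult coeff_pcompose_monom coeff_sect)
    moreover have "i \<le> k \<and> n dvd k - i \<longleftrightarrow> i = k mod n"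
      using that by (metis mod_eq_dvd_iff_nat mod_less mod_less_eq_dividend)
    ultimately show ?thesis by auto
  qed
  show "coeff W k = coeff (\<Sum>i<n. (poly_section n i W \<circ>\<^sub>p monom 1 n) * monom 1 i) k"
    using assms by (simp add: coeff_sum eq)
qed

text \<open>
  The outer variable of \<open>'a poly poly\<close> is \<open>y\<close> and the inner one is \<open>t\<close>. The map \<open>subst_t n\<close> sets
  \<open>t = y\<^sup>n\<close>, which identifies \<open>R[t][y]\<close> modulo \<open>y\<^sup>n - t\<close> with \<open>R[y]\<close>; \<open>lift\<close> is the inverse.
\<close>

definition subst_t :: "nat \<Rightarrow> 'a::comm_ring_1 poly poly \<Rightarrow> 'a poly" where
  "subst_t n f = poly (map_poly (\<lambda>c. c \<circ>\<^sub>p monom 1 n) f) [:0, 1:]"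

lemma subst_t_0 [simp]: "subst_t n 0 = 0"
  by (simp add: subst_t_def)

lemma subst_t_pCons: "subst_t n (pCons c f) = c \<circ>\<^sub>p monom 1 n + pCons 0 (subst_t n f)"
  by (cases "c = 0 \<and> f = 0") (auto simp: subst_t_def map_poly_pCons)

lemma subst_t_add: "subst_t n (f + g) = subst_t n f + subst_t n g"
proof (induction f arbitrary: g)
  case (pCons a f)
  then show ?case by (cases g) (simp add: subst_t_pCons pcompose_add algebra_simps)
qed simp

lemma subst_t_smult: "subst_t n (smult c f) = (c \<circ>\<^sub>p monom 1 n) * subst_t n f"
  by (induction f) (simp_all add: subst_t_pCons pcompose_mult algebra_simps)

lemma subst_t_mult: "subst_t n (f * g) = subst_t n f * subst_t n g"
  by (induction f) (simp_all add: subst_t_add subst_t_smult subst_t_pCons algebra_simps)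

lemma subst_t_diff: "subst_t n (f - g) = subst_t n f - subst_t n g"
  using subst_t_add[of n "f - g" g] by simp

lemma subst_t_monom: "subst_t n (monom c k) = (c \<circ>\<^sub>p monom 1 n) * monom 1 k"
  by (induction k) (simp_all add: monom_0 monom_Suc subst_t_pCons flip: one_pCons)

lemma subst_t_sum: "subst_t n (sum f I) = (\<Sum>x\<in>I. subst_t n (f x))"
  by (induction I rule: infinite_finite_induct) (simp_all add: subst_t_add)

definition lift :: "'a::comm_ring_1 poly \<Rightarrow> 'a poly poly" where
  "lift f = map_poly (\<lambda>c. [:c:]) f"

lemma lift_0 [simp]: "lift 0 = 0"
  by (simp add: lift_def)

lemma lift_pCons: "lift (pCons a f) = pCons [:a:] (lift f)"
  by (simp add: lift_def map_poly_pCons)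

lemma lift_add: "lift (f + g) = lift f + lift g"
  by (rule poly_eqI) (simp add: lift_def coeff_map_poly)

lemma lift_diff: "lift (f - g) = lift f - lift g"
  by (rule poly_eqI) (simp add: lift_def coeff_map_poly)

lemma lift_smult: "lift (smult c f) = smult [:c:] (lift f)"
  by (rule poly_eqI) (simp add: lift_def coeff_map_poly)

lemma lift_mult: "lift (f * g) = lift f * lift g"
  by (induction f) (simp_all add: lift_pCons lift_add lift_smult algebra_simps)

lemma lift_1 [simp]: "lift 1 = 1"
  by (simp add: one_pCons lift_pCons)

lemma lift_power: "lift (f ^ k) = lift f ^ k"
  by (induction k) (simp_all add: lift_mult)

lemma lift_monom: "lift (monom 1 k) = monom 1 k"
  by (induction k) (simp_all add: monom_0 monom_Suc lift_pCons flip: one_pCons)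

lemma subst_t_lift [simp]: "subst_t n (lift f) = f"
  by (induction f) (simp_all add: lift_pCons subst_t_pCons)

abbreviation X_binomial :: "nat \<Rightarrow> 'a::comm_ring_1 poly poly" where
  "X_binomial n \<equiv> monom 1 n - [:monom 1 1:]"

lemma subst_t_X_binomial [simp]: "subst_t n (X_binomial n) = 0"
  by (simp add: subst_t_diff subst_t_monom subst_t_pCons pcompose_monom_monom pcompose_1)

text \<open>Horner's scheme for \<open>A\<close>: each replacement of a factor \<open>y^n\<close> by
  \<open>t\<close> costs a multiple of \<open>y^n - t\<close>.\<close>

lemma X_binomial_dvd_lift_pcompose:
  "X_binomial n dvd lift (A \<circ>\<^sub>p monom 1 n) - [:A:]"
proof (induction A)
  case (pCons a A)
  have "lift (pCons a A \<circ>\<^sub>p monom 1 n) - [:pCons a A:] =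
      X_binomial n * lift (A \<circ>\<^sub>p monom 1 n) + [:monom 1 1:] * (lift (A \<circ>\<^sub>p monom 1 n) - [:A:])"
    by (simp add: pcompose_pCons lift_add lift_pCons lift_mult lift_monom algebra_simps monom_Suc)
  then show ?case using pCons.IH by (simp only: dvd_add dvd_triv_left dvd_mult)
qed simp

lemma degree_X_binomial:
  assumes "n > 0"
  shows "degree (X_binomial n :: 'a::comm_ring_1 poly poly) = n"
    and "lead_coeff (X_binomial n :: 'a::comm_ring_1 poly poly) = 1"
proof -
  have "degree [:- monom (1::'a) 1:] < degree (monom (1::'a poly) n)"
    using assms by (simp add: degree_monom_eq)
  moreover have "(X_binomial n :: 'a poly poly) = monom 1 n + [:- monom 1 1:]" by simp
  ultimately show "degree (X_binomial n :: 'a poly poly) = n"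
    by (metis degree_add_eq_left degree_monom_eq one_neq_zero)
  then show "lead_coeff (X_binomial n :: 'a poly poly) = 1"
    using assms by (simp add: coeff_pCons split: nat.splits)
qed

section \<open>Irreducibility over a field\<close>

text \<open>Modulo \<open>y^n - t\<close> the polynomial \<open>A(y^n)\<close> becomes the scalar
  \<open>A(t)\<close>, so the norm turns \<open>Q^q = y\<close> modulo \<open>A(y^n)\<close> into a
  congruence modulo \<open>A\<close>, with the norm of \<open>y\<close> on the right.\<close>

lemma power_descent:
  fixes A Q :: "'a::idom poly"
  assumes "n > 0" "A \<circ>\<^sub>p monom 1 n dvd Q ^ q - monom 1 1"
  shows "\<exists>N. A dvd N ^ q - (-1) ^ Suc n * monom 1 1"
proof -
  interpret monic_modulus "X_binomial n :: 'a poly poly"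
    by unfold_locales (rule degree_X_binomial[OF assms(1)])
  obtain W where W: "Q ^ q - monom 1 1 = (A \<circ>\<^sub>p monom 1 n) * W"
    using assms(2) by (elim dvdE)
  obtain S where S: "lift (A \<circ>\<^sub>p monom 1 n) = X_binomial n * S + [:A:]"
    using X_binomial_dvd_lift_pcompose[of n A] by (elim dvdE) (metis diff_eq_eq)
  have "lift Q ^ q - monom 1 1 = lift (A \<circ>\<^sub>p monom 1 n) * lift W"
    using arg_cong[OF W, of lift] by (simp add: lift_diff lift_mult lift_power lift_monom)
  also have "\<dots> = X_binomial n * (S * lift W) + smult A (lift W)"
    unfolding S by (simp add: ring_distribs mult.assoc)
  finally have "A dvd quot_norm (X_binomial n) (lift Q ^ q) - quot_norm (X_binomial n) (monom 1 1)"
    by (rule quot_norm_cong)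
  then show ?thesis
    unfolding quot_norm_power quot_norm_X_binomial[OF assms(1)] by blast
qed

text \<open>\<open>A(y^q)\<close> divides \<open>R^q - y^q\<close>, which has the factor
  \<open>R - y\<close>. Each of the two factors has a section that is a unit, so
  \<open>A(y^q)\<close> divides neither.\<close>

lemma not_prime_elem_if_power:
  fixes A Q :: "'a::idom poly"
  assumes "q > 1" "A dvd Q ^ q - monom 1 1" "\<not> A dvd 1"
  shows "\<not> prime_elem (A \<circ>\<^sub>p monom 1 q)"
proof
  assume prime: "prime_elem (A \<circ>\<^sub>p monom 1 q)"
  define R where "R = Q \<circ>\<^sub>p monom 1 q"
  define T where "T = (\<Sum>i<q. monom 1 1 ^ (q - Suc i) * R ^ i)"
  have "A \<circ>\<^sub>p monom 1 q dvd (Q ^ q - monom 1 1) \<circ>\<^sub>p monom 1 q"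
    by (rule pcompose_dvd) (rule assms)
  also have "\<dots> = R ^ q - monom 1 1 ^ q"
    by (simp add: R_def pcompose_diff pcompose_power pcompose_monom_monom monom_power)
  also have "\<dots> = (R - monom 1 1) * T"
    unfolding T_def by (rule power_diff_sumr2)
  finally consider "A \<circ>\<^sub>p monom 1 q dvd R - monom 1 1" | "A \<circ>\<^sub>p monom 1 q dvd T"
    using prime by (auto dest: prime_elem_dvd_multD)
  then show False
  proof cases
    case 1
    from dvd_poly_section[OF _ this, of 1] have "A dvd - 1"
      using assms(1) by (simp add: R_def poly_section_diff poly_section_pcompose poly_section_monom del: One_nat_def)
    then show False using assms(3) by simp
  next
    case 2
    \<comment> \<open>\<open>R\<close> is a polynomial in \<open>y^q\<close>, so summand
      \<open>i\<close> only has exponents congruent to \<open>q - 1 - i\<close>; only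
      \<open>i = 0\<close> contributes.\<close>
    have "poly_section q (q - 1) (monom 1 1 ^ (q - Suc i) * R ^ i) = (if i = 0 then 1 else 0)"
      if "i < q" for i
    proof -
      have "poly_section q (q - 1) ((Q ^ i \<circ>\<^sub>p monom 1 q) * monom 1 (q - Suc i)) = (if i = 0 then 1 else 0)"
        using that assms(1) by (auto simp: poly_section_mult poly_section_monom)
      then show ?thesis by (simp add: R_def pcompose_power monom_power mult.commute)
    qed
    then have "poly_section q (q - 1) T = 1" using assms(1) by (simp add: T_def poly_section_sum)
    with dvd_poly_section[OF _ 2, of "q - 1"] show False using assms(1,3) by simp
  qed
qed

text \<open>
  Write \<open>D = D\<^sub>0(y\<^sup>2) + y D\<^sub>1(y\<^sup>2)\<close>. The even and odd parts of \<open>D\<^sup>2 + y\<close> give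
  \<open>D\<^sub>0\<^sup>2 + t D\<^sub>1\<^sup>2 \<equiv> 0\<close> and \<open>2 D\<^sub>0 D\<^sub>1 \<equiv> -1\<close> modulo \<open>A\<close>, and so \<open>t \<equiv> -4 D\<^sub>0\<^sup>4\<close>.
\<close>

lemma fourth_power_descent:
  fixes A D :: "'a::idom poly"
  assumes "A \<circ>\<^sub>p monom 1 2 dvd D ^ 2 + monom 1 1"
  shows "\<exists>U. A dvd monom 1 1 + 4 * U ^ 4"
proof -
  define D0 D1 where "D0 = poly_section 2 0 D" and "D1 = poly_section 2 1 D"
  define E0 E1 where "E0 = D0 \<circ>\<^sub>p monom 1 2" and "E1 = D1 \<circ>\<^sub>p monom 1 2"
  define y where "y = (monom 1 1 :: 'a poly)"
  have D: "D = E0 + E1 * y"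
  proof -
    have "(\<Sum>i<2. g i) = g 0 + g 1" for g :: "nat \<Rightarrow> 'a poly"
      by (simp add: numeral_2_eq_2)
    from this[of "\<lambda>i. (poly_section 2 i D \<circ>\<^sub>p monom 1 2) * monom 1 i"] show ?thesis
      using poly_section_decomposition[of 2 D]
      by (simp only: D0_def D1_def E0_def E1_def y_def zero_less_numeral simp_thms monom_0
          one_pCons[symmetric] mult_1_right)
  qed
  have y2: "y \<circ>\<^sub>p monom 1 2 = y ^ 2"
    by (simp add: y_def pcompose_monom_monom monom_power)
  have "D ^ 2 + y = (E0 ^ 2 + y ^ 2 * E1 ^ 2) * monom 1 0 + (E0 * E1 + E0 * E1 + 1) * y"
    unfolding D by (simp add: monom_0 algebra_simps power2_eq_square flip: one_pCons)
  also have "E0 ^ 2 + y ^ 2 * E1 ^ 2 = (D0 ^ 2 + y * D1 ^ 2) \<circ>\<^sub>p monom 1 2"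
    by (simp only: pcompose_add pcompose_mult pcompose_power y2 E0_def E1_def)
  also have "E0 * E1 + E0 * E1 + 1 = (D0 * D1 + D0 * D1 + 1) \<circ>\<^sub>p monom 1 2"
    by (simp only: pcompose_add pcompose_mult pcompose_1 E0_def E1_def)
  finally have "D ^ 2 + monom 1 1 = ((D0 ^ 2 + monom 1 1 * D1 ^ 2) \<circ>\<^sub>p monom 1 2) * monom 1 0
      + ((D0 * D1 + D0 * D1 + 1) \<circ>\<^sub>p monom 1 2) * monom 1 1"
    unfolding y_def .
  moreover have "poly_section 2 i ((V \<circ>\<^sub>p monom 1 2) * monom 1 0 + (W \<circ>\<^sub>p monom 1 2) * monom 1 1) =
      (if i = 0 then V else W)" if "i < 2" for i and V W :: "'a poly"
    using that by (auto simp: poly_section_add poly_section_mult poly_section_monom poly_section_pcompose less_2_cases_iff simp del: One_nat_def)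
  ultimately have "poly_section 2 0 (D ^ 2 + monom 1 1) = D0 ^ 2 + monom 1 1 * D1 ^ 2"
    and "poly_section 2 1 (D ^ 2 + monom 1 1) = D0 * D1 + D0 * D1 + 1"
    by (simp_all only: zero_less_numeral one_less_numeral_iff semiring_norm simp_thms if_True if_False
        one_neq_zero)
  then have "A dvd D0 ^ 2 + monom 1 1 * D1 ^ 2" "A dvd D0 * D1 + D0 * D1 + 1"
    using dvd_poly_section[OF _ assms, of 0] dvd_poly_section[OF _ assms, of 1] by simp_all
  \<comment> \<open>The multipliers are chosen so that the terms \<open>4 t D0^2 D1^2\<close>
    cancel, using \<open>(2 D0 D1 - 1)(2 D0 D1 + 1) = 4 D0^2 D1^2 - 1\<close>.\<close>
  then have "A dvd 4 * D0 ^ 2 * (D0 ^ 2 + monom 1 1 * D1 ^ 2)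
      - monom 1 1 * (2 * D0 * D1 - 1) * (D0 * D1 + D0 * D1 + 1)"
    by (intro dvd_diff dvd_mult)
  also have "\<dots> = monom 1 1 + 4 * D0 ^ 4"
    by (simp add: algebra_simps power2_eq_square power4_eq_xxxx)
  finally show ?thesis by blast
qed

text \<open>Sophie Germain's identity factors \<open>y^4 + 4 V^4\<close>; in both factors the
  section at exponent 2 is 1, which \<open>A\<close> does not divide.\<close>

lemma not_prime_elem_if_fourth_power:
  fixes A U :: "'a::idom poly"
  assumes "A dvd monom 1 1 + 4 * U ^ 4" "\<not> A dvd 1"
  shows "\<not> prime_elem (A \<circ>\<^sub>p monom 1 4)"
proof
  assume prime: "prime_elem (A \<circ>\<^sub>p monom 1 4)"
  define V where "V = U \<circ>\<^sub>p monom 1 4"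
  define y where "y = (monom 1 1 :: 'a poly)"
  have "A \<circ>\<^sub>p monom 1 4 dvd (monom 1 1 + 4 * U ^ 4) \<circ>\<^sub>p monom 1 4"
    by (rule pcompose_dvd) (rule assms)
  also have "\<dots> = y ^ 4 + 4 * V ^ 4"
    by (simp add: V_def y_def pcompose_add pcompose_mult pcompose_power pcompose_monom_monom
        pcompose_smult monom_power numeral_poly)
  also have "\<dots> = (y ^ 2 + (2 * V * y + 2 * V ^ 2)) * (y ^ 2 + (2 * V ^ 2 - 2 * V * y))"
    by (simp add: algebra_simps power2_eq_square power4_eq_xxxx)
  finally have "A \<circ>\<^sub>p monom 1 4 dvd y ^ 2 + (2 * V * y + 2 * V ^ 2) \<or>
      A \<circ>\<^sub>p monom 1 4 dvd y ^ 2 + (2 * V ^ 2 - 2 * V * y)"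
    using prime by (auto dest: prime_elem_dvd_multD)
  moreover have "poly_section 4 2 (y ^ 2) = 1"
    by (simp add: y_def monom_power poly_section_monom)
  moreover have "poly_section 4 2 (2 * V * y) = 0"
    using poly_section_mult[of 2 4 "2 * U" y]
    by (simp add: V_def y_def pcompose_mult pcompose_smult numeral_poly poly_section_monom)
  moreover have "poly_section 4 2 (2 * V ^ 2) = 0"
    using poly_section_pcompose[of 2 4 "2 * U ^ 2"]
    by (simp add: V_def pcompose_mult pcompose_smult pcompose_power numeral_poly)
  ultimately have "A dvd poly_section 4 2 (y ^ 2) \<or> A dvd poly_section 4 2 (y ^ 2)"
    using dvd_poly_section[of 2 4 A "y ^ 2 + (2 * V * y + 2 * V ^ 2)"]
      dvd_poly_section[of 2 4 A "y ^ 2 + (2 * V ^ 2 - 2 * V * y)"]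
    by (simp only: poly_section_add poly_section_diff zero_less_numeral add_0_right diff_0_right) (simp, blast)
  with \<open>poly_section 4 2 (y ^ 2) = 1\<close> assms(2) show False by simp
qed

text \<open>A nonzero element of least degree in the ideal generated by \<open>c\<close> and
  \<open>A\<close> divides both, hence is a unit.\<close>

lemma irreducible_field_poly_bezout:
  fixes A c :: "'a::field poly"
  assumes "irreducible A" "\<not> A dvd c"
  obtains u v where "u * c + v * A = 1"
proof -
  define I where "I = (\<lambda>g. g \<noteq> 0 \<and> (\<exists>u v. g = u * c + v * A))"
  have "A = 0 * c + 1 * A" by simp
  then have "I A"
    using assms(1) unfolding I_def irreducible_def by blast
  then obtain g where g: "I g" and min: "\<And>h. I h \<Longrightarrow> degree g \<le> degree h"
    using ex_has_least_nat[of I A degree] by blast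
  then obtain u v where uv: "g \<noteq> 0" "g = u * c + v * A" by (auto simp: I_def)
  have dvd: "g dvd h" if h: "h = u' * c + v' * A" for h u' v'
  proof -
    have "h mod g = (u' - h div g * u) * c + (v' - h div g * v) * A"
      unfolding minus_div_mult_eq_mod[symmetric, of h g] by (subst (2) uv(2)) (simp add: h algebra_simps)
    then have "I (h mod g)" if "h mod g \<noteq> 0" using that by (auto simp: I_def)
    then have "h mod g = 0" using min degree_mod_less'[OF uv(1), of h] by force
    then show ?thesis by (simp add: mod_eq_0_iff_dvd)
  qed
  have "g dvd A" "g dvd c" using dvd[of A 0 1] dvd[of c 1 0] by simp_all
  then have "is_unit g"
    using assms irreducibleD'[of A g] dvd_trans by blast
  then obtain h where "1 = g * h" by (elim dvdE)
  then have "(u * h) * c + (v * h) * A = 1" by (simp add: uv(2) algebra_simps)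
  then show ?thesis using that by blast
qed

lemma dvd_power_diff: "a dvd x - y \<Longrightarrow> a dvd x ^ n - y ^ n" for a :: "'a::comm_ring_1"
  by (simp add: power_diff_sumr2)

lemma const_dvd_obtain_smult:
  fixes f :: "'a::idom poly"
  assumes "\<And>i. a dvd coeff f i"
  obtains u where "f = smult a u"
  using assms const_poly_dvd_iff[of a f] by (auto elim!: dvdE)

text \<open>
  Let \<open>G\<close> be a proper factor of \<open>A(y\<^sup>q)\<close>, \<open>\<beta>\<close> a root of \<open>G\<close> and \<open>\<alpha> = \<beta>\<^sup>q\<close>. The polynomial \<open>M\<close> below
  represents the monic polynomial over \<open>K(\<alpha>) = K[t]/A\<close> of least degree \<open>d\<close> that vanishes at \<open>\<beta>\<close>. As
  \<open>0 < d < q\<close> and \<open>M\<close> divides \<open>y\<^sup>q - t\<close> modulo \<open>A\<close>, the norm \<open>b\<close> of \<open>y\<close> modulo \<open>M\<close> satisfies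
  \<open>b\<^sup>q \<equiv> t\<^sup>d\<close>; since \<open>d\<close> and \<open>q\<close> are coprime, \<open>t\<close> itself is a \<open>q\<close>-th power modulo \<open>A\<close>.
\<close>

lemma power_if_reducible:
  fixes A :: "'a::field poly"
  assumes A: "irreducible A" "\<not> A dvd monom 1 1"
    and q: "prime q" and reducible: "\<not> irreducible (A \<circ>\<^sub>p monom 1 q)"
  shows "\<exists>Q. A dvd Q ^ q - monom 1 1"
proof -
  have q0: "q > 0" using q by (simp add: prime_gt_0_nat)
  define B where "B = A \<circ>\<^sub>p monom 1 q"
  have A0: "A \<noteq> 0" and "degree A > 0"
    using A(1) by (auto simp: irreducible_def is_unit_iff_degree)
  moreover have degB: "degree B = degree A * q"
    by (simp add: B_def degree_pcompose degree_monom_eq)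
  ultimately have "degree B > 0" using q0 by simp
  moreover from this have "B \<noteq> 0" by auto
  ultimately have "\<not> is_unit B" by (simp add: is_unit_iff_degree)
  with \<open>B \<noteq> 0\<close> obtain G H where GH: "B = G * H" "\<not> is_unit G" "\<not> is_unit H"
    using reducible by (auto simp: irreducible_def B_def)
  then have "G \<noteq> 0" "H \<noteq> 0" using \<open>B \<noteq> 0\<close> by auto
  then have degG: "degree G < degree A * q"
    using GH by (simp add: degB[symmetric] degree_mult_eq is_unit_iff_degree)

  \<comment> \<open>\<open>I\<close> is the ideal of relations that hold modulo \<open>G\<close>
    after setting \<open>t = y^q\<close>; a \<open>good\<close> relation is one that is nonzero
    modulo \<open>A\<close>.\<close>
  define I where "I = (\<lambda>f. G dvd subst_t q f)"
  define good where "good = (\<lambda>f. I f \<and> (\<exists>i. \<not> A dvd coeff f i))"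
  have subst_t_const_mult: "I (monom (v * A) k)" for v k
    by (simp add: I_def subst_t_monom pcompose_mult GH(1) flip: B_def)

  define P0 where "P0 = (\<Sum>i<q. monom (poly_section q i G) i)"
  have coeff_P0: "coeff P0 i = (if i < q then poly_section q i G else 0)" for i
    by (simp add: P0_def coeff_sum)
  have "subst_t q P0 = G"
    unfolding P0_def subst_t_sum subst_t_monom using poly_section_decomposition[OF q0] by metis
  then have "I P0" by (simp add: I_def)
  obtain i where i: "i < q" "poly_section q i G \<noteq> 0"
  proof (rule ccontr)
    assume "\<not> thesis"
    then have "\<And>i. i < q \<Longrightarrow> poly_section q i G = 0" using that by blast
    then have "G = 0" by (subst poly_section_decomposition[OF q0]) simp
    then show False using \<open>G \<noteq> 0\<close> by simp
  qed
  \<comment> \<open>Since \<open>G\<close> has degree below \<open>q\<close> times that of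
    \<open>A\<close>, its nonzero sections are too short to be divisible by
    \<open>A\<close>.\<close>
  have "degree (poly_section q i G) < degree A"
  proof (rule ccontr)
    assume "\<not> degree (poly_section q i G) < degree A"
    then have "degree A * q \<le> q * degree (poly_section q i G) + i"
      by (simp add: mult.commute trans_le_add1)
    then have "coeff (poly_section q i G) (degree (poly_section q i G)) = 0"
      using degG q0 by (simp add: coeff_sect coeff_eq_0)
    then show False using i by simp
  qed
  then have "\<not> A dvd poly_section q i G"
    using i(2) dvd_imp_degree_le[of A "poly_section q i G"] by auto
  then have "good P0"
    using \<open>I P0\<close> i coeff_P0 by (auto simp: good_def)
  have "degree P0 < q"
    using q0 by (intro degree_lessI) (auto simp: coeff_P0)

  obtain P where P: "good P" and min: "\<And>f. good f \<Longrightarrow> degree P \<le> degree f"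
    using ex_has_least_nat[of good P0 degree] \<open>good P0\<close> by blast
  define d where "d = degree P"
  have "d < q" using min[OF \<open>good P0\<close>] \<open>degree P0 < q\<close> by (simp add: d_def)
  \<comment> \<open>Otherwise the leading term could be dropped without leaving \<open>I\<close>,
    since \<open>A(y^q)\<close> is a multiple of \<open>G\<close>; this would give a good relation
    of smaller degree.\<close>
  have lead: "\<not> A dvd lead_coeff P"
  proof
    assume *: "A dvd lead_coeff P"
    then obtain v where v: "lead_coeff P = v * A" by (metis dvd_def mult.commute)
    define P' where "P' = P - monom (v * A) d"
    obtain j where j: "\<not> A dvd coeff P j" using P by (auto simp: good_def)
    then have "j \<noteq> d" using * by (auto simp: d_def)
    then have j': "\<not> A dvd coeff P' j" using j by (simp add: P'_def)
    have "I P'"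
      using P subst_t_const_mult[of v d] by (simp add: good_def I_def P'_def subst_t_diff)
    then have "good P'" using j' by (auto simp: good_def)
    then have "d \<le> degree P'" using min by (simp add: d_def)
    moreover have "coeff P' i = 0" if "i \<ge> d" for i
      using that v by (cases "i = d") (simp_all add: P'_def d_def coeff_eq_0)
    ultimately have "P' = 0" by (metis leading_coeff_0_iff)
    then show False using j' by simp
  qed
  obtain u v where uv: "u * lead_coeff P + v * A = 1"
    using irreducible_field_poly_bezout[OF A(1) lead] by blast
  \<comment> \<open>Here \<open>u\<close> inverts the leading coefficient modulo \<open>A\<close>;
    the second summand makes it exactly 1, so that norms modulo \<open>M\<close> are
    available.\<close>
  define M where "M = smult u P + monom (v * A) d"
  have "coeff M d = 1" using uv by (simp add: M_def d_def)
  moreover have "degree M \<le> d"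
    unfolding M_def by (intro degree_add_le) (auto simp: d_def degree_monom_le intro: order.trans[OF degree_smult_le])
  ultimately have degM: "degree M = d" by (simp add: le_degree order_antisym)
  then interpret monic_modulus M
    using \<open>coeff M d = 1\<close> by unfold_locales simp
  have "I M"
    using P subst_t_const_mult[of v d] by (auto simp: good_def I_def M_def subst_t_add subst_t_smult)
  have "d > 0"
  proof (rule ccontr)
    assume "\<not> d > 0"
    then have "M = [:1:]" using degM \<open>coeff M d = 1\<close> by (auto elim: degree_eq_zeroE)
    then show False using \<open>I M\<close> GH(2) by (simp add: I_def subst_t_pCons pcompose_1)
  qed

  define R where "R = pseudo_mod (X_binomial q) M"
  obtain s where s: "X_binomial q - R = M * s"
    using dvd_pseudo_mod_diff[of "X_binomial q"] by (auto simp: R_def elim!: dvdE)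
  have "- subst_t q R = subst_t q M * subst_t q s"
    using arg_cong[OF s, of "subst_t q"] by (simp only: subst_t_diff[of q "X_binomial q" R] subst_t_X_binomial subst_t_mult diff_0)
  then have "I R" using \<open>I M\<close> unfolding I_def by (metis dvd_minus_iff dvd_mult2)
  \<comment> \<open>\<open>R\<close> lies in \<open>I\<close> and has no terms from degree
    \<open>d\<close> upwards, so minimality of \<open>d\<close> forces it to vanish modulo
    \<open>A\<close>.\<close>
  have "A dvd coeff R i" for i
  proof (rule ccontr)
    assume *: "\<not> A dvd coeff R i"
    then have "R \<noteq> 0" by auto
    moreover have "d \<le> degree R" using min * \<open>I R\<close> by (auto simp: good_def d_def)
    ultimately show False
      using coeff_pseudo_mod_eq_0[of "degree R" "X_binomial q", folded R_def, unfolded degM] by simp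
  qed
  then obtain w where w: "R = smult A w" by (rule const_dvd_obtain_smult)
  define b where "b = quot_norm M (monom 1 1)"
  have "monom 1 q - [:monom 1 1:] = M * s + smult A w"
    using s w by (simp add: algebra_simps)
  from quot_norm_cong[OF this] have "A dvd quot_norm M (monom 1 1 ^ q) - monom 1 1 ^ d"
    by (simp add: quot_norm_const degM monom_power)
  then have b: "A dvd b ^ q - monom 1 1 ^ d" by (simp only: quot_norm_power b_def)

  have "coprime d q"
    using q \<open>d > 0\<close> \<open>d < q\<close> by (metis coprime_commute nat_dvd_not_less prime_imp_coprime)
  moreover obtain g x z where "g dvd d" "g dvd q" "d * x = q * z + g"
    using bezout_add_strong_nat[of d q] \<open>d > 0\<close> by blast
  ultimately have xz: "d * x = q * z + 1"
    using coprime_common_divisor_nat by metis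
  obtain e v' where "e * monom 1 1 + v' * A = 1"
    using irreducible_field_poly_bezout[OF A] by blast
  then have "monom 1 1 * e - 1 = A * (- v')" by (simp add: algebra_simps)
  then have "A dvd monom 1 1 * e - 1" by (rule dvdI)
  then have e: "A dvd (monom 1 1 * e) ^ (q * z) - 1 ^ (q * z)" by (rule dvd_power_diff)
  \<comment> \<open>With \<open>e\<close> inverse to \<open>t\<close> modulo \<open>A\<close> and
    \<open>d x = q z + 1\<close>, one gets \<open>t = t^(d x) e^(q z) = (b^x e^z)^q\<close> modulo
    \<open>A\<close>.\<close>
  define t where "t = (monom 1 1 :: 'a poly)"
  have "A dvd ((b ^ q) ^ x - (t ^ d) ^ x) * e ^ (q * z) + t * ((t * e) ^ (q * z) - 1)"
    using dvd_power_diff[OF b, of x] e by (simp add: t_def)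
  also have "\<dots> = (b ^ x * e ^ z) ^ q - t"
  proof -
    have "(t ^ d) ^ x = t * t ^ (q * z)" by (simp add: xz flip: power_mult)
    then show ?thesis
      by (simp add: algebra_simps power_mult_distrib flip: power_mult)
  qed
  finally show ?thesis unfolding t_def by blast
qed

section \<open>Capelli's criterion for prime exponents and its extension to all exponents\<close>

lemma irreducible_pcompose_monom_iff:
  fixes A :: "'a::field poly"
  assumes "irreducible A" "\<not> A dvd monom 1 1" "prime q"
  shows "irreducible (A \<circ>\<^sub>p monom 1 q) \<longleftrightarrow> \<not> (\<exists>Q. A dvd Q ^ q - monom 1 1)"
proof
  assume "irreducible (A \<circ>\<^sub>p monom 1 q)"
  then have "prime_elem (A \<circ>\<^sub>p monom 1 q)" by (rule field_poly_irreducible_imp_prime)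
  moreover have "\<not> A dvd 1" using assms(1) by (simp add: irreducible_def)
  ultimately show "\<not> (\<exists>Q. A dvd Q ^ q - monom 1 1)"
    using not_prime_elem_if_power[of q A] prime_gt_1_nat[OF assms(3)] by blast
next
  assume "\<not> (\<exists>Q. A dvd Q ^ q - monom 1 1)"
  then show "irreducible (A \<circ>\<^sub>p monom 1 q)" using power_if_reducible[OF assms] by blast
qed

text \<open>Keeps the root 0 excluded when \<open>A\<close> is replaced by \<open>A(y^n)\<close>, as
  the induction on the exponent requires.\<close>

lemma pcompose_monom_not_dvd:
  assumes "\<not> A dvd monom (1::'a::comm_ring_1) 1" "n > 0"
  shows "\<not> A \<circ>\<^sub>p monom 1 n dvd monom 1 1"
proof
  assume "A \<circ>\<^sub>p monom 1 n dvd monom 1 1"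
  then have "A \<circ>\<^sub>p monom 1 n dvd monom 1 1 ^ n"
    using assms(2) by (meson dvd_power dvd_trans)
  then have "A \<circ>\<^sub>p monom 1 n dvd monom 1 1 \<circ>\<^sub>p monom 1 n"
    by (simp add: pcompose_monom_monom monom_power)
  then show False
    using dvd_poly_section[of 0 n A "monom 1 1 \<circ>\<^sub>p monom 1 n"] assms by (simp add: poly_section_pcompose)
qed

text \<open>For odd \<open>p\<close> the norm of \<open>y\<close> is \<open>t\<close> itself, so a
  \<open>q\<close>-th power relation for \<open>A(y^p)\<close> descends to one for
  \<open>A\<close>.\<close>

lemma irreducible_pcompose_odd_times_prime:
  fixes A :: "'a::field poly"
  assumes A: "irreducible A" "\<not> A dvd monom 1 1"
    and "odd p" "prime q"
    and "irreducible (A \<circ>\<^sub>p monom 1 p)" "irreducible (A \<circ>\<^sub>p monom 1 q)"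
  shows "irreducible (A \<circ>\<^sub>p monom 1 (p * q))"
proof (rule ccontr)
  assume *: "\<not> irreducible (A \<circ>\<^sub>p monom 1 (p * q))"
  have p: "p > 0" using assms(3) odd_pos by blast
  obtain Q where "A \<circ>\<^sub>p monom 1 p dvd Q ^ q - monom 1 1"
    using irreducible_pcompose_monom_iff[OF assms(5) pcompose_monom_not_dvd[OF A(2) p] assms(4)] *
    by (auto simp: pcompose_monom_pcompose_monom)
  then obtain N where "A dvd N ^ q - (-1) ^ Suc p * monom 1 1"
    using power_descent[OF p] by blast
  then show False
    using irreducible_pcompose_monom_iff[OF A assms(4)] assms(3,6) by auto
qed

text \<open>Reducibility at 8 makes \<open>y\<close> a square modulo \<open>A(y^4)\<close>.
  Descending by exponent 2 makes \<open>-y\<close> a square modulo \<open>A(y^2)\<close>, hence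
  \<open>t = -4 U^4\<close> modulo \<open>A\<close>, which contradicts irreducibility at 4.\<close>

lemma irreducible_pcompose_monom_8:
  fixes A :: "'a::field poly"
  assumes A: "irreducible A" "\<not> A dvd monom 1 1"
    and 4: "irreducible (A \<circ>\<^sub>p monom 1 4)"
  shows "irreducible (A \<circ>\<^sub>p monom 1 8)"
proof (rule ccontr)
  assume *: "\<not> irreducible (A \<circ>\<^sub>p monom 1 8)"
  obtain Q where "A \<circ>\<^sub>p monom 1 4 dvd Q ^ 2 - monom 1 1"
    using irreducible_pcompose_monom_iff[OF 4 pcompose_monom_not_dvd[OF A(2)], of 2] *
    by (auto simp: pcompose_monom_pcompose_monom)
  then have "(A \<circ>\<^sub>p monom 1 2) \<circ>\<^sub>p monom 1 2 dvd Q ^ 2 - monom 1 1"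
    by (simp add: pcompose_monom_pcompose_monom)
  from power_descent[OF _ this] obtain N where "A \<circ>\<^sub>p monom 1 2 dvd N ^ 2 + monom 1 1"
    by auto
  then obtain U where "A dvd monom 1 1 + 4 * U ^ 4"
    using fourth_power_descent by blast
  then show False
    using not_prime_elem_if_fourth_power field_poly_irreducible_imp_prime[OF 4] A(1)
    by (auto simp: irreducible_def)
qed

theorem irreducible_pcompose_monom:
  fixes A :: "'a::field poly"
  assumes "irreducible A" "\<not> A dvd monom 1 1" "n > 0"
    and "\<And>p. prime p \<Longrightarrow> p dvd n \<Longrightarrow> irreducible (A \<circ>\<^sub>p monom 1 p)"
    and "4 dvd n \<Longrightarrow> irreducible (A \<circ>\<^sub>p monom 1 4)"
  shows "irreducible (A \<circ>\<^sub>p monom 1 n)"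
  using assms
proof (induction n arbitrary: A rule: less_induct)
  case (less n)
  note A = less.prems(1,2) and primes = less.prems(4) and four = less.prems(5)
  \<comment> \<open>Peeling off \<open>p\<close> replaces \<open>A\<close> by \<open>A(y^p)\<close>;
    the induction hypothesis then asks for irreducibility at \<open>p q\<close> for primes
    \<open>q\<close> dividing \<open>m\<close>, and at \<open>4 p\<close> if 4 divides
    \<open>m\<close>.\<close>
  have step: "irreducible (A \<circ>\<^sub>p monom 1 n)"
    if p: "prime p" "n = p * m"
      and *: "\<And>q. prime q \<Longrightarrow> q dvd m \<Longrightarrow> irreducible (A \<circ>\<^sub>p monom 1 (p * q))"
      and **: "4 dvd m \<Longrightarrow> irreducible (A \<circ>\<^sub>p monom 1 (p * 4))" for p m
  proof -
    have "irreducible ((A \<circ>\<^sub>p monom 1 p) \<circ>\<^sub>p monom 1 m)"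
    proof (rule less.IH)
      show "m < n" "m > 0" using less.prems(3) p by (auto simp: prime_gt_Suc_0_nat)
      show "irreducible (A \<circ>\<^sub>p monom 1 p)" using primes p by simp
      show "\<not> A \<circ>\<^sub>p monom 1 p dvd monom 1 1"
        using pcompose_monom_not_dvd[OF A(2)] p by (simp add: prime_gt_0_nat)
    qed (simp_all add: pcompose_monom_pcompose_monom * **)
    then show ?thesis by (simp add: pcompose_monom_pcompose_monom p)
  qed
  show ?case
  proof (cases "\<exists>p. prime p \<and> odd p \<and> p dvd n")
    case True
    then obtain p m where p: "prime p" "odd p" "n = p * m" by (auto elim!: dvdE)
    have 1: "irreducible (A \<circ>\<^sub>p monom 1 (p * q))" if "prime q" "q dvd n" for q
      using irreducible_pcompose_odd_times_prime[OF A p(2) that(1)] primes that p by simp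
    have 2: "irreducible (A \<circ>\<^sub>p monom 1 (p * 4))" if "4 dvd n"
    proof -
      have 2: "2 dvd n" using that by (rule dvd_trans[rotated]) simp
      \<comment> \<open>The odd case is applied to \<open>A(y^2)\<close> with the prime 2, from
        exponents \<open>2 p\<close> and 4.\<close>
      have "irreducible ((A \<circ>\<^sub>p monom 1 2) \<circ>\<^sub>p monom 1 (p * 2))"
        using primes[OF _ 2] four[OF that] 1[OF _ 2] pcompose_monom_not_dvd[OF A(2)] p(2)
        by (intro irreducible_pcompose_odd_times_prime)
          (simp_all add: pcompose_monom_pcompose_monom mult.commute)
      then show ?thesis by (simp add: pcompose_monom_pcompose_monom mult.commute)
    qed
    show ?thesis
      by (rule step[OF p(1,3)]) (auto intro!: 1 2 simp: p)
  next
    case False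
    show ?thesis
    proof (cases "n = 1")
      case True
      then show ?thesis using A(1) by (simp add: monom_1_Suc_0)
    next
      case n1: False
      then obtain p where "prime p" "p dvd n" using prime_factor_nat by blast
      then obtain m where m: "n = 2 * m" using False by (metis dvdE prime_odd_nat prime_ge_2_nat le_neq_implies_less two_is_prime_nat)
      show ?thesis
      proof (rule step[OF two_is_prime_nat m])
        fix q :: nat assume q: "prime q" "q dvd m"
        then have "q = 2" using False m by (metis dvd_mult prime_odd_nat prime_ge_2_nat le_neq_implies_less)
        then show "irreducible (A \<circ>\<^sub>p monom 1 (2 * q))" using four q m by auto
      next
        assume "4 dvd m"
        then have "4 dvd n" using m by simp
        then show "irreducible (A \<circ>\<^sub>p monom 1 (2 * 4))"
          using irreducible_pcompose_monom_8[OF A] four by simp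
      qed
    qed
  qed
qed

section \<open>Congruences modulo a prime\<close>

lemma prime_dvd_binomial_power:
  fixes a b :: "'a::comm_ring_1"
  assumes "prime p"
  shows "of_nat p dvd (a + b) ^ p - a ^ p - b ^ p"
proof -
  let ?t = "\<lambda>k. of_nat (p choose k) * a ^ k * b ^ (p - k)"
  have p: "p > 0" using assms by (simp add: prime_gt_0_nat)
  have "{..p} = insert 0 (insert p {0<..<p})" using p by auto
  then have "(a + b) ^ p - a ^ p - b ^ p = sum ?t {0<..<p}"
    using p by (simp add: binomial_ring)
  moreover have "of_nat p dvd ?t k" if "k \<in> {0<..<p}" for k
  proof -
    have "p dvd (p choose k)" using that assms by (intro dvd_choose_prime) auto
    then have "of_nat p dvd (of_nat (p choose k) :: 'a)" by (auto elim!: dvdE)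
    then show ?thesis by (simp add: mult.assoc)
  qed
  ultimately show ?thesis by (auto intro: dvd_sum)
qed

lemma prime_dvd_sum_power:
  fixes f :: "'b \<Rightarrow> 'a::comm_ring_1"
  assumes "prime p"
  shows "of_nat p dvd (\<Sum>i\<in>I. f i) ^ p - (\<Sum>i\<in>I. f i ^ p)"
proof (induction I rule: infinite_finite_induct)
  case (insert x I)
  from dvd_add[OF prime_dvd_binomial_power[OF assms, of "f x" "sum f I"] insert.IH]
  show ?case using insert.hyps by (simp add: algebra_simps)
qed (use assms in \<open>simp_all add: prime_gt_0_nat zero_power\<close>)

text \<open>For nonnegative \<open>a\<close>, write \<open>a\<close> as a sum of ones. Expanding
  \<open>(m + (-m))^p\<close> modulo \<open>p\<close> then gives negative \<open>a\<close> without a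
  case split on the parity of \<open>p\<close>.\<close>

lemma fermat_int:
  fixes a :: int
  assumes "prime p"
  shows "int p dvd a ^ p - a"
proof -
  have nat: "int p dvd int m ^ p - int m" for m
    using prime_dvd_sum_power[OF assms, of "\<lambda>_. 1 :: int" "{..<m}"] by simp
  have "int p dvd (- int m) ^ p - (- int m)" for m
  proof -
    have "int p dvd - (int m ^ p + (- int m) ^ p)"
      using prime_dvd_binomial_power[OF assms, of "int m" "- int m"] prime_gt_0_nat[OF assms]
      by (simp add: algebra_simps zero_power)
    from dvd_diff[OF dvd_minus_iff[THEN iffD2, OF nat[of m]] this] show ?thesis
      by (simp add: algebra_simps)
  qed
  then show ?thesis using nat by (cases a rule: int_cases2) blast+
qed

text \<open>Only the coefficients are raised to the \<open>p\<close>-th power, not the variable;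
  this is the polynomial \<open>G'\<close> with \<open>G^p = G'(y^p)\<close> modulo
  \<open>p\<close>.\<close>

definition frob :: "nat \<Rightarrow> 'a::comm_ring_1 poly \<Rightarrow> 'a poly" where
  "frob p G = (\<Sum>j\<le>degree G. monom (coeff G j ^ p) j)"

lemma coeff_frob:
  assumes "p > 0"
  shows "coeff (frob p G) j = coeff G j ^ p"
proof (cases "j \<le> degree G")
  case False
  then have "coeff G j = 0" by (simp add: coeff_eq_0)
  then show ?thesis using False assms by (simp add: frob_def coeff_sum zero_power)
qed (simp add: frob_def coeff_sum)

lemma prime_dvd_power_diff_frob:
  fixes G :: "'a::comm_ring_1 poly"
  assumes "prime p"
  shows "of_nat p dvd G ^ p - (frob p G \<circ>\<^sub>p monom 1 p)"
proof -
  have "frob p G \<circ>\<^sub>p monom 1 p = (\<Sum>j\<le>degree G. monom (coeff G j ^ p) j \<circ>\<^sub>p monom 1 p)"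
    by (simp add: frob_def pcompose_sum)
  also have "\<dots> = (\<Sum>j\<le>degree G. monom (coeff G j) j ^ p)"
  proof (rule sum.cong, rule refl)
    fix j
    have "smult c (monom 1 j) \<circ>\<^sub>p monom 1 p = monom c (p * j)" for c :: 'a
      by (simp only: pcompose_smult pcompose_monom_monom) (simp add: smult_monom mult.commute)
    then show "monom (coeff G j ^ p) j \<circ>\<^sub>p monom 1 p = monom (coeff G j) j ^ p"
      by (simp add: smult_monom monom_power mult.commute)
  qed
  finally show ?thesis
    using prime_dvd_sum_power[OF assms, of "\<lambda>j. monom (coeff G j) j" "{..degree G}"]
    by (simp add: poly_as_sum_of_monoms)
qed

section \<open>The norm from \<open>R[y]\<close> to \<open>R[y^n]\<close>, written as a polynomial
  in \<open>t = y^n\<close>\<close>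

definition rel_norm :: "nat \<Rightarrow> 'a::idom poly \<Rightarrow> 'a poly" where
  "rel_norm n G = quot_norm (X_binomial n) (lift G)"

lemma monic_modulus_X_binomial:
  "n > 0 \<Longrightarrow> monic_modulus (X_binomial n :: 'a::idom poly poly)"
  by unfold_locales (rule degree_X_binomial)

lemma rel_norm_mult: "n > 0 \<Longrightarrow> rel_norm n (G * H) = rel_norm n G * rel_norm n H"
  unfolding rel_norm_def lift_mult by (rule monic_modulus.quot_norm_mult[OF monic_modulus_X_binomial])

lemma rel_norm_power: "n > 0 \<Longrightarrow> rel_norm n (G ^ k) = rel_norm n G ^ k"
  unfolding rel_norm_def lift_power by (rule monic_modulus.quot_norm_power[OF monic_modulus_X_binomial])

lemma rel_norm_cong:
  assumes "n > 0" "of_nat a dvd G - (A \<circ>\<^sub>p monom 1 n)"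
  shows "of_nat a dvd rel_norm n G - A ^ n"
proof -
  interpret monic_modulus "X_binomial n :: 'a poly poly"
    using assms(1) by (rule monic_modulus_X_binomial)
  have lift_of_nat: "lift (of_nat a) = (of_nat a :: 'a poly poly)"
    by (induction a) (simp_all add: lift_add)
  obtain W where "G - (A \<circ>\<^sub>p monom 1 n) = of_nat a * W"
    using assms(2) by (elim dvdE)
  from arg_cong[OF this, of lift] have W: "lift G - lift (A \<circ>\<^sub>p monom 1 n) = smult (of_nat a) (lift W)"
    by (simp only: lift_diff lift_mult lift_of_nat) (simp add: of_nat_poly)
  obtain S where "lift (A \<circ>\<^sub>p monom 1 n) - [:A:] = X_binomial n * S"
    using X_binomial_dvd_lift_pcompose[of n A] by (elim dvdE)
  with W have "lift G - [:A:] = X_binomial n * S + smult (of_nat a) (lift W)"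
    by (simp only: diff_eq_eq) (simp add: algebra_simps)
  from quot_norm_cong[OF this] show ?thesis
    unfolding rel_norm_def quot_norm_const degree_X_binomial(1)[OF assms(1)] .
qed

text \<open>The case of modulus 0, where congruence is equality.\<close>

lemma rel_norm_pcompose:
  "n > 0 \<Longrightarrow> rel_norm n (A \<circ>\<^sub>p monom 1 n) = A ^ n"
  using rel_norm_cong[of n 0 "A \<circ>\<^sub>p monom 1 n" A] by simp

text \<open>Setting \<open>t = y^n\<close> in the adjugate relation shows that \<open>G\<close>
  divides its own norm evaluated at \<open>y^n\<close>.\<close>

lemma rel_norm_unitD:
  fixes G :: "'a::idom poly"
  assumes "n > 0" "rel_norm n G dvd 1"
  shows "G dvd 1"
proof -
  interpret monic_modulus "X_binomial n :: 'a poly poly"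
    using assms(1) by (rule monic_modulus_X_binomial)
  obtain v s where "lift G * v - [:rel_norm n G:] = X_binomial n * s"
    using dvd_mult_diff_quot_norm[of "lift G"] degree_X_binomial(1)[OF assms(1), where ?'a = 'a] assms(1)
    unfolding rel_norm_def by (auto elim!: dvdE)
  from arg_cong[OF this, of "subst_t n"] have "G * subst_t n v = rel_norm n G \<circ>\<^sub>p monom 1 n"
    by (simp only: subst_t_diff[of n "lift G * v"] subst_t_mult subst_t_lift subst_t_X_binomial mult_zero_left
        subst_t_pCons subst_t_0 pCons_0_0 add_0_right) simp
  moreover have "rel_norm n G \<circ>\<^sub>p monom 1 n dvd 1"
    using pcompose_dvd[OF assms(2), of "monom 1 n"] by (simp add: pcompose_1)
  ultimately show ?thesis by (metis dvd_mult_left)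
qed

text \<open>The \<open>p\<close>-th powers of both sides agree modulo \<open>p\<close>, so
  \<open>p\<close> divides the \<open>p\<close>-th power of the difference; as \<open>p\<close> is a
  prime element, it divides the difference.\<close>

lemma prime_dvd_rel_norm_diff_frob:
  fixes G :: "'a::idom poly"
  assumes "prime p" "prime_elem (of_nat p :: 'a poly)"
  shows "of_nat p dvd rel_norm p G - frob p G"
proof -
  have p: "p > 0" using assms(1) by (simp add: prime_gt_0_nat)
  define N where "N = rel_norm p G"
  have "of_nat p dvd N ^ p - frob p G ^ p"
    using rel_norm_cong[OF p prime_dvd_power_diff_frob[OF assms(1)], of G] p
    by (simp add: rel_norm_power N_def)
  moreover have "of_nat p dvd N ^ p - (N - frob p G) ^ p - frob p G ^ p"
    using prime_dvd_binomial_power[OF assms(1), of "N - frob p G" "frob p G"] by simp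
  ultimately have "of_nat p dvd (N ^ p - frob p G ^ p) - (N ^ p - (N - frob p G) ^ p - frob p G ^ p)"
    by (rule dvd_diff)
  then have "of_nat p dvd (N - frob p G) ^ p" by simp
  then show ?thesis using assms(2) unfolding N_def by (rule prime_elem_dvd_power[rotated])
qed

lemma factor_of_prime_power:
  fixes A :: "'a::algebraic_semidom"
  assumes "prime_elem A" "x * y = A ^ n"
  shows "\<exists>u s. s \<le> n \<and> is_unit u \<and> x = u * A ^ s"
  using assms(2)
proof (induction n arbitrary: x y)
  case 0
  then show ?case by (auto intro!: exI[of _ x] exI[of _ 0] dvdI[of _ x y])
next
  case (Suc n)
  have A: "A \<noteq> 0" using assms(1) by auto
  have "A dvd x * y" using Suc.prems by simp
  then consider "A dvd x" | "A dvd y" using prime_elem_dvd_multD[OF assms(1)] by auto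
  then show ?case
  proof cases
    case 1
    then obtain x' where x': "x = A * x'" by (elim dvdE)
    then have "A * (x' * y) = A * A ^ n" using Suc.prems by (simp add: mult.assoc)
    then have "x' * y = A ^ n" using A by simp
    from Suc.IH[OF this] obtain u s where "s \<le> n" "is_unit u" "x' = u * A ^ s" by (elim exE conjE)
    then show ?thesis using x' by (intro exI[of _ u] exI[of _ "Suc s"]) (simp add: mult.left_commute)
  next
    case 2
    then obtain y' where y': "y = A * y'" by (elim dvdE)
    then have "A * (x * y') = A * A ^ n" using Suc.prems by (simp add: mult.left_commute)
    then have "x * y' = A ^ n" using A by simp
    from Suc.IH[OF this] obtain u s where "s \<le> n" "is_unit u" "x = u * A ^ s" by (elim exE conjE)
    then show ?thesis by (intro exI[of _ u] exI[of _ s]) simp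
  qed
qed

text \<open>The norms of \<open>G\<close> and \<open>H\<close> multiply to \<open>A^n\<close>. The
  exponents 0 and \<open>n\<close> would make one of these norms, and hence \<open>G\<close> or
  \<open>H\<close>, a unit.\<close>

lemma rel_norm_factor:
  fixes A G H :: "'a::idom_divide poly"
  assumes "prime_elem A" "n > 0" "A \<circ>\<^sub>p monom 1 n = G * H" "\<not> G dvd 1" "\<not> H dvd 1"
  shows "\<exists>u s. 0 < s \<and> s < n \<and> is_unit u \<and> rel_norm n G = u * A ^ s"
proof -
  have GH: "rel_norm n G * rel_norm n H = A ^ n"
    using rel_norm_pcompose[OF assms(2), of A] by (simp add: assms(2,3) rel_norm_mult)
  then obtain u s where s: "s \<le> n" "is_unit u" "rel_norm n G = u * A ^ s"
    using factor_of_prime_power[OF assms(1)] by blast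
  have "s \<noteq> 0"
  proof
    assume "s = 0"
    then have "rel_norm n G dvd 1" using s by simp
    then show False using rel_norm_unitD[OF assms(2)] assms(4) by blast
  qed
  moreover have "s \<noteq> n"
  proof
    assume "s = n"
    then have "A ^ n * (u * rel_norm n H) = A ^ n * 1"
      using GH s by (simp add: algebra_simps)
    moreover have "A ^ n \<noteq> 0" using assms(1) by (simp add: prime_elem_def)
    ultimately have "u * rel_norm n H = 1" by (simp only: mult_cancel_left) simp
    then have "rel_norm n H dvd 1" by (intro dvdI[of _ _ u]) (simp add: mult.commute)
    then show False using rel_norm_unitD[OF assms(2)] assms(5) by blast
  qed
  ultimately show ?thesis using s by (intro exI[of _ u] exI[of _ s]) simp
qed

section \<open>Differentiation with respect to \<open>x\<close> modulo a prime\<close>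

abbreviation x_deriv :: "int poly poly \<Rightarrow> int poly poly" where
  "x_deriv \<equiv> map_poly pderiv"

lemma x_deriv_diff: "x_deriv (F - G) = x_deriv F - x_deriv G"
  by (rule poly_eqI) (simp add: coeff_map_poly pderiv_diff)

lemma x_deriv_mult: "x_deriv (F * G) = F * x_deriv G + x_deriv F * G"
proof (rule poly_eqI)
  fix j
  have "pderiv (sum h I) = (\<Sum>i\<in>I. pderiv (h i))" for h :: "nat \<Rightarrow> int poly" and I
    by (induction I rule: infinite_finite_induct) (simp_all add: pderiv_add)
  then show "coeff (x_deriv (F * G)) j = coeff (F * x_deriv G + x_deriv F * G) j"
    by (simp add: coeff_map_poly coeff_mult pderiv_mult sum.distrib) (simp add: mult.commute)
qed

lemma x_deriv_power: "x_deriv (F ^ Suc n) = of_nat (Suc n) * F ^ n * x_deriv F"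
  by (induction n) (simp_all add: x_deriv_mult algebra_simps)

lemma of_nat_dvd_bipoly_iff:
  "of_nat p dvd (F :: int poly poly) \<longleftrightarrow> (\<forall>j i. int p dvd coeff (coeff F j) i)"
  by (simp add: of_nat_poly const_poly_dvd_iff)

lemma prime_elem_of_nat_bipoly: "prime p \<Longrightarrow> prime_elem (of_nat p :: int poly poly)"
  by (simp add: of_nat_poly lift_prime_elem_poly)

lemma x_deriv_of_nat [simp]: "x_deriv (of_nat p) = 0"
  by (simp add: of_nat_poly map_poly_pCons pderiv_pCons)

lemma x_deriv_unit:
  assumes "is_unit u"
  shows "x_deriv u = 0"
proof -
  obtain c where c: "u = [:c:]" "is_unit c" using assms by (rule is_unit_polyE)
  then obtain d where "c = [:d:]" by (auto elim: is_unit_polyE)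
  then show ?thesis using c by (simp add: map_poly_pCons pderiv_pCons)
qed

text \<open>Differentiating \<open>u F^s = frob p G\<close> modulo \<open>p\<close> kills the
  right-hand side, so \<open>p\<close> divides \<open>u s F^(s-1)\<close> times the derivative of
  \<open>F\<close>. It divides none of the factors before the derivative, because
  \<open>0 < s < p\<close>.\<close>

lemma prime_dvd_x_deriv:
  fixes F :: "int poly poly"
  assumes F: "irreducible F" "degree F > 0"
    and p: "prime p" and reducible: "reducible (F \<circ>\<^sub>p monom 1 p)"
  shows "of_nat p dvd x_deriv F"
proof -
  have p0: "p > 0" using p by (simp add: prime_gt_0_nat)
  have prime: "prime_elem (of_nat p :: int poly poly)" using p by (rule prime_elem_of_nat_bipoly)
  obtain G H where "F \<circ>\<^sub>p monom 1 p = G * H" "\<not> is_unit G" "\<not> is_unit H"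
    using reducible by (auto simp: reducible_def irreducible_def)
  then obtain u s where s: "0 < s" "s < p" and u: "is_unit u" and N: "rel_norm p G = u * F ^ s"
    using rel_norm_factor[OF irreducible_imp_prime_poly[OF F(1)] p0] by blast
  obtain m where m: "s = Suc m" using s(1) by (cases s) auto
  have "of_nat p dvd u * F ^ s - frob p G"
    using prime_dvd_rel_norm_diff_frob[OF p prime, of G] N by simp
  then obtain W where W: "u * F ^ s - frob p G = of_nat p * W" by (elim dvdE)
  have "x_deriv (u * F ^ s) - x_deriv (frob p G) = of_nat p * x_deriv W"
    using arg_cong[OF W, of x_deriv] by (simp only: x_deriv_diff x_deriv_mult x_deriv_of_nat mult_zero_left add_0_right)
  moreover have "of_nat p dvd x_deriv (frob p G)"
  proof -
    obtain k where "p = Suc k" using p0 by (cases p) auto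
    then show ?thesis
      unfolding of_nat_dvd_bipoly_iff
      by (simp add: coeff_map_poly coeff_frob pderiv_power_Suc del: power_Suc of_nat_Suc)
  qed
  ultimately have "of_nat p dvd x_deriv (u * F ^ s)"
    by (metis diff_eq_eq dvd_add dvd_triv_left)
  then have "of_nat p dvd u * (of_nat s * (F ^ m * x_deriv F))"
    using u by (simp add: m x_deriv_mult x_deriv_unit x_deriv_power mult.assoc del: power_Suc of_nat_Suc)
  then have *: "of_nat p dvd u \<or> of_nat p dvd (of_nat s :: int poly poly) \<or> of_nat p dvd F ^ m \<or>
      of_nat p dvd x_deriv F"
    by (simp only: prime_elem_dvd_mult_iff[OF prime])
  have "\<not> of_nat p dvd u"
    using u prime by (meson dvd_trans prime_elem_not_unit)
  moreover have "\<not> of_nat p dvd (of_nat s :: int poly poly)"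
  proof
    assume "of_nat p dvd (of_nat s :: int poly poly)"
    then have "int p dvd coeff (coeff (of_nat s :: int poly poly) 0) 0"
      unfolding of_nat_dvd_bipoly_iff by blast
    then have "p dvd s" by (simp add: of_nat_poly)
    then show False using s by (auto dest: dvd_imp_le)
  qed
  moreover have "\<not> of_nat p dvd F"
  proof
    assume "of_nat p dvd F"
    then obtain V where V: "F = of_nat p * V" by (elim dvdE)
    then have "is_unit V" using irreducibleD[OF F(1) V] prime by (auto simp: prime_elem_def)
    then have "degree V = 0" by (auto elim: is_unit_polyE)
    then have "degree F = 0" using V by (simp add: of_nat_poly)
    then show False using F(2) by simp
  qed
  then have "\<not> of_nat p dvd F ^ m" using prime_elem_dvd_power[OF prime] by blast
  ultimately show ?thesis using * by blast
qed

text \<open>Modulo \<open>p\<close> only exponents divisible by \<open>p\<close> survive in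
  \<open>f\<close>. Dividing them by \<open>p\<close> gives the section \<open>g\<close>, and
  Fermat's congruence on the coefficients gives \<open>g^p = f\<close> modulo
  \<open>p\<close>.\<close>

lemma prime_power_congruence:
  fixes f :: "int poly"
  assumes p: "prime p" and deriv: "\<And>i. int p dvd coeff (pderiv f) i"
  shows "int p dvd coeff (f - poly_section p 0 f ^ p) i"
proof -
  have p0: "p > 0" using p by (simp add: prime_gt_0_nat)
  define g where "g = poly_section p 0 f"
  have "of_nat p dvd g ^ p - (frob p g \<circ>\<^sub>p monom 1 p)"
    using p by (rule prime_dvd_power_diff_frob)
  then have 1: "int p dvd coeff (g ^ p) i - coeff (frob p g \<circ>\<^sub>p monom 1 p) i"
    by (simp add: of_nat_poly const_poly_dvd_iff)
  have 2: "int p dvd coeff (frob p g \<circ>\<^sub>p monom 1 p) i - coeff f i"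
  proof (cases "p dvd i")
    case True
    then show ?thesis
      using p0 fermat_int[OF p] by (simp add: coeff_pcompose_monom coeff_frob g_def coeff_sect)
  next
    case False
    then obtain k where k: "i = Suc k" by (cases i) auto
    have "int p dvd int i * coeff f i"
      using deriv[of k] by (simp add: coeff_pderiv k)
    moreover have "\<not> int p dvd int i" using False by simp
    ultimately have "int p dvd coeff f i"
      using p by (simp add: prime_dvd_mult_iff)
    then show ?thesis using False p0 by (simp add: coeff_pcompose_monom)
  qed
  from dvd_add[OF 1 2] show ?thesis
    unfolding g_def[symmetric] by (simp add: dvd_diff_commute)
qed

text \<open>Gauss's lemma passes to the fraction field of the coefficient ring; substituting
  \<open>y^n\<close> keeps the polynomial primitive.\<close>

theorem irreducible_bipoly_pcompose_monom:
  fixes F :: "int poly poly"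
  assumes F: "irreducible F" "degree F > 0" "\<not> F dvd monom 1 1" and n: "n > 0"
    and primes: "\<And>p. prime p \<Longrightarrow> p dvd n \<Longrightarrow> irreducible (F \<circ>\<^sub>p monom 1 p)"
    and 4: "4 dvd n \<Longrightarrow> irreducible (F \<circ>\<^sub>p monom 1 4)"
  shows "irreducible (F \<circ>\<^sub>p monom 1 n)"
proof -
  have deg: "degree (F \<circ>\<^sub>p monom 1 k) \<noteq> 0" if "k > 0" for k
    using that F(2) by (simp add: degree_pcompose degree_monom_eq)
  have fract: "fract_poly (F \<circ>\<^sub>p monom 1 k) = fract_poly F \<circ>\<^sub>p monom 1 k" if "k > 0" for k
    using that by (intro poly_eqI) (simp add: coeff_pcompose_monom coeff_map_poly)
  have iff: "irreducible (F \<circ>\<^sub>p monom 1 k) \<longleftrightarrow>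
      irreducible (fract_poly F \<circ>\<^sub>p monom 1 k) \<and> content (F \<circ>\<^sub>p monom 1 k) = 1" if "k > 0" for k
    using nonconst_poly_irreducible_iff[OF deg[OF that]] fract[OF that] by simp
  have content: "content F = 1" and irr: "irreducible (fract_poly F)"
    using nonconst_poly_irreducible_iff[of F] F by auto
  have "content (F \<circ>\<^sub>p monom 1 n) dvd coeff F j" for j
    using content_dvd_coeff[of "F \<circ>\<^sub>p monom 1 n" "n * j"] n by (simp add: coeff_pcompose_monom)
  then have "content (F \<circ>\<^sub>p monom 1 n) dvd content F"
    unfolding const_poly_dvd_iff_dvd_content[symmetric] const_poly_dvd_iff by blast
  then have content_n: "content (F \<circ>\<^sub>p monom 1 n) = 1"
    using content using is_unit_content_iff[of "F \<circ>\<^sub>p monom 1 n"] by simp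
  have "irreducible (fract_poly F \<circ>\<^sub>p monom 1 n)"
  proof (rule irreducible_pcompose_monom[OF irr _ n])
    show "\<not> fract_poly F dvd monom 1 1"
      using F(3) fract_poly_dvdD[OF _ content, of "monom 1 1"] by (auto simp: map_poly_monom)
  qed (use primes 4 iff in \<open>auto simp: prime_gt_0_nat\<close>)
  then show ?thesis using iff[OF n] content_n by simp
qed

section \<open>The criterion for integer polynomials\<close>

lemma abs_coeff_le_height: "\<bar>coeff f i\<bar> \<le> height f"
proof (cases "i \<le> degree f")
  case True
  then show ?thesis unfolding height_def by (intro Max_ge) auto
next
  case False
  moreover have "\<bar>coeff f 0\<bar> \<le> height f" unfolding height_def by (intro Max_ge) auto
  ultimately show ?thesis by (simp add: coeff_eq_0)
qed

text \<open>Otherwise the top coefficient of the derivative is divisible by \<open>p\<close>. Since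
  \<open>p\<close> exceeds the degree, it divides the leading coefficient, which is nonzero and
  smaller than \<open>p\<close> in absolute value.\<close>

lemma degree_eq_0_if_small:
  assumes "int p > height f" "degree f < p" and p: "prime p"
    and deriv: "\<And>i. int p dvd coeff (pderiv f) i"
  shows "degree f = 0"
proof (rule ccontr)
  assume "degree f \<noteq> 0"
  then obtain k where k: "degree f = Suc k" by (cases "degree f") auto
  have "int p dvd int (Suc k) * lead_coeff f"
    using deriv[of k] by (simp add: coeff_pderiv k)
  moreover have "\<not> int p dvd int (Suc k)"
    using assms(2) k by (auto simp: int_dvd_int_iff simp del: of_nat_Suc dest: dvd_imp_le)
  ultimately have "int p dvd lead_coeff f"
    using p by (simp add: prime_dvd_mult_iff del: of_nat_Suc)
  moreover have "f \<noteq> 0" using k by auto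
  then have "lead_coeff f \<noteq> 0" by simp
  ultimately have "int p \<le> \<bar>lead_coeff f\<bar>" using dvd_imp_le_int[of "lead_coeff f" "int p"] by simp
  then show False using assms(1) abs_coeff_le_height[of f "degree f"] by simp
qed

theorem theorem2:
  fixes r :: nat and f :: "nat \<Rightarrow> int poly" and F :: "int poly poly" and P :: "nat set"
  assumes "r \<ge> 1"
    and "F = (\<Sum>j=0..r. monom (f j) j)"
    and "f r \<noteq> 0"
    and "irreducible F"
    and "\<exists>j\<in>{0..r}. degree (f j) > 0"
    and "P = exceptional_primes r f"
  shows "(\<forall>n>0. reducible (subst_y_power F n) \<longleftrightarrow>
            (\<exists>p\<in>P. p dvd n \<and> reducible (subst_y_power F p)) \<or>
            (2 dvd n \<and> reducible (subst_y_power F 2)) \<or>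
            (4 dvd n \<and> reducible (subst_y_power F 4))) \<and>
         ((\<forall>p\<in>P. irreducible (subst_y_power F p)) \<and> irreducible (subst_y_power F 4) \<longrightarrow>
            (\<forall>n>0. irreducible (subst_y_power F n))) \<and>
         (\<forall>p\<in>P \<union> {2}. reducible (subst_y_power F p) \<longrightarrow>
            (\<exists>g :: nat \<Rightarrow> int poly. bipoly_cong F (\<Sum>j=0..r. monom (g j ^ p) j) p))"
proof -
  let ?F = "\<lambda>n. subst_y_power F n"
  have coeff_F: "coeff F j = (if j \<le> r then f j else 0)" for j
    by (simp add: assms(2) coeff_sum)
  have "degree F \<le> r" by (intro degree_le) (simp add: coeff_F)
  then have deg: "degree F = r" using assms(3) by (intro antisym le_degree) (simp_all add: coeff_F)
  have F: "irreducible F" "degree F > 0" using assms(1,4) deg by auto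

  \<comment> \<open>A divisor of \<open>y\<close> of positive degree in \<open>y\<close> has the
    form \<open>c y\<close> with a unit \<open>c\<close>, so every \<open>f j\<close> would be
    constant.\<close>
  have not_dvd: "\<not> F dvd monom 1 1"
  proof
    assume "F dvd monom 1 1"
    then obtain S where S: "monom 1 1 = F * S" by (elim dvdE)
    have "S \<noteq> 0" "F \<noteq> 0" using S F(2) by (auto simp: monom_eq_0_iff)
    then have "1 = degree F + degree S"
      using arg_cong[OF S, of degree] by (simp add: degree_mult_eq degree_monom_eq)
    then have r1: "r = 1" and "degree S = 0" using deg F(2) by auto
    then obtain c where c: "S = [:c:]" by (auto elim: degree_eq_zeroE)
    have "c \<noteq> 0" using \<open>S \<noteq> 0\<close> c by auto
    have eq: "coeff (monom 1 1) j = c * coeff F j" for j using S c by simp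
    have "degree (f 1) = 0"
      using arg_cong[OF eq[of 1], of degree] \<open>c \<noteq> 0\<close> assms(3) r1 by (simp add: coeff_F degree_mult_eq)
    moreover have "f 0 = 0" using eq[of 0] \<open>c \<noteq> 0\<close> by (simp add: coeff_F)
    ultimately have "degree (f j) = 0" if "j \<in> {0..r}" for j
      using that r1 by (cases j) auto
    then show False using assms(5) by auto
  qed

  have reducible_iff: "reducible (?F n) \<longleftrightarrow> \<not> irreducible (?F n)" if "n > 0" for n
  proof -
    have "degree (?F n) \<noteq> 0"
      using F(2) that by (simp add: subst_y_power_def degree_pcompose degree_monom_eq)
    then show ?thesis by (auto simp: reducible_def elim: is_unit_polyE)
  qed

  have deriv: "int p dvd coeff (pderiv (f j)) i"
    if "prime p" "reducible (?F p)" "j \<le> r" for p i j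
  proof -
    have "of_nat p dvd x_deriv F"
      using prime_dvd_x_deriv[OF F that(1)] that(2) by (simp add: subst_y_power_def)
    then have "int p dvd coeff (coeff (x_deriv F) j) i"
      unfolding of_nat_dvd_bipoly_iff by blast
    then show ?thesis using that(3) by (simp add: coeff_map_poly coeff_F)
  qed

  have exceptional: "p \<in> P" if p: "prime p" "odd p" and red: "reducible (?F p)" for p
  proof (rule ccontr)
    let ?X = "(\<lambda>j. int (degree (f j))) ` {0..r} \<union> (\<lambda>j. height (f j)) ` {0..r}"
    assume "p \<notin> P"
    then have "\<not> int p \<le> Max ?X" using p unfolding assms(6) exceptional_primes_def by blast
    then have less: "Max ?X < int p" by (rule not_le[THEN iffD1])
    have "degree (f j) = 0" if "j \<in> {0..r}" for j
    proof (rule degree_eq_0_if_small[OF _ _ p(1)])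
      have "height (f j) \<le> Max ?X" "int (degree (f j)) \<le> Max ?X"
        using that by (auto intro!: Max_ge)
      then show "height (f j) < int p" "degree (f j) < p" using less by linarith+
      show "int p dvd coeff (pderiv (f j)) i" for i using deriv[OF p(1) red] that by simp
    qed
    then show False using assms(5) by auto
  qed

  have reducible_mult: "reducible (?F n)" if red: "reducible (?F m)" and dvd: "m dvd n" and n: "n > 0" for m n
  proof -
    obtain k where k: "n = m * k" using dvd by (elim dvdE)
    have "m > 0" "k > 0" using n k by auto
    obtain G H where GH: "?F m = G * H" "\<not> is_unit G" "\<not> is_unit H"
      using red by (auto simp: reducible_def irreducible_def)
    \<comment> \<open>The section at 0 recovers \<open>V\<close> from \<open>V(y^k)\<close>, so the
      substituted factors remain nonunits.\<close>
    have unit: "is_unit V" if "is_unit (V \<circ>\<^sub>p monom 1 k)" for V :: "int poly poly"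
      using dvd_poly_section[of 0 k V "V \<circ>\<^sub>p monom 1 k"] \<open>k > 0\<close> that
        dvd_poly_section[of 0 k V 1] poly_section_monom[of 0 k 0, where ?'a = "int poly"]
      by (simp add: monom_0 flip: one_pCons)
    have "?F n = (G \<circ>\<^sub>p monom 1 k) * (H \<circ>\<^sub>p monom 1 k)"
      by (simp only: k subst_y_power_def pcompose_mult[symmetric] GH(1)[symmetric]
          pcompose_monom_pcompose_monom)
    then have "\<not> irreducible (?F n)"
      using GH(2,3) unit irreducibleD by blast
    then show ?thesis using reducible_iff[OF n] by simp
  qed

  have main: "(\<exists>p\<in>P. p dvd n \<and> reducible (?F p)) \<or> (2 dvd n \<and> reducible (?F 2)) \<or>
      (4 dvd n \<and> reducible (?F 4))" if "reducible (?F n)" "n > 0" for n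
  proof (rule ccontr)
    assume *: "\<not> ?thesis"
    have "irreducible (F \<circ>\<^sub>p monom 1 n)"
    proof (rule irreducible_bipoly_pcompose_monom[OF F not_dvd that(2)])
      fix p :: nat assume p: "prime p" "p dvd n"
      have "\<not> reducible (?F p)"
      proof (cases "p = 2")
        case False
        then have "odd p" using p(1) primes_dvd_imp_eq two_is_prime_nat by blast
        then show ?thesis using * exceptional[OF p(1)] p by blast
      qed (use * p in auto)
      then show "irreducible (F \<circ>\<^sub>p monom 1 p)"
        using reducible_iff[of p] p(1) by (simp add: subst_y_power_def prime_gt_0_nat)
    next
      assume "4 dvd n"
      then show "irreducible (F \<circ>\<^sub>p monom 1 4)"
        using * reducible_iff[of 4] by (simp add: subst_y_power_def)
    qed
    then show False using that reducible_iff by (simp add: subst_y_power_def)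
  qed

  have congruence: "\<exists>g. bipoly_cong F (\<Sum>j=0..r. monom (g j ^ p) j) p"
    if p: "prime p" "reducible (?F p)" for p
  proof (intro exI)
    define g where "g j = poly_section p 0 (f j)" for j
    have "int p dvd coeff (coeff (F - (\<Sum>j=0..r. monom (g j ^ p) j)) j) i" for j i
    proof (cases "j \<le> r")
      case True
      then have "coeff (F - (\<Sum>j=0..r. monom (g j ^ p) j)) j = f j - poly_section p 0 (f j) ^ p"
        by (simp add: coeff_F coeff_sum g_def)
      then show ?thesis
        using prime_power_congruence[OF p(1), of "f j" i] deriv[OF p True] by simp
    qed (simp add: coeff_F coeff_sum)
    then show "bipoly_cong F (\<Sum>j=0..r. monom (g j ^ p) j) p" by (simp add: bipoly_cong_def)
  qed

  have P: "prime p" if "p \<in> P \<union> {2}" for p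
    using that by (auto simp: assms(6) exceptional_primes_def)
  show ?thesis
  proof (intro conjI allI impI ballI)
    fix n :: nat assume n: "n > 0"
    show "reducible (?F n) \<longleftrightarrow> (\<exists>p\<in>P. p dvd n \<and> reducible (?F p)) \<or>
        (2 dvd n \<and> reducible (?F 2)) \<or> (4 dvd n \<and> reducible (?F 4))"
      using main[OF _ n] reducible_mult[OF _ _ n] by blast
  next
    fix n :: nat
    assume *: "(\<forall>p\<in>P. irreducible (?F p)) \<and> irreducible (?F 4)" and n: "n > 0"
    then have "\<not> reducible (?F p)" if "p \<in> P" for p
      using that by (auto simp: reducible_def)
    moreover have "\<not> reducible (?F 4)" using * by (auto simp: reducible_def)
    \<comment> \<open>A factorization at exponent 2 would persist at exponent 4.\<close>
    moreover from this have "\<not> reducible (?F 2)" using reducible_mult[of 2 4] by auto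
    ultimately show "irreducible (?F n)" using main[OF _ n] reducible_iff[OF n] by blast
  next
    fix p assume "p \<in> P \<union> {2}" "reducible (?F p)"
    then show "\<exists>g. bipoly_cong F (\<Sum>j=0..r. monom (g j ^ p) j) p"
      using congruence P by blast
  qed
qed

end
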